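(* Let $E$ be an elliptic curve over $\mathbb C$ together with a pair of elements $(\xi,\eta)$ of the total Tate module $TE$. Assume $\xi\neq0$. Then the corresponding $\mathbb Q$-lattice (up to scale) belongs to the range of the map $\theta$ from parabolic $\mathbb Q$-lattices to $\mathbb Q$-lattices up to scale if and only if one has $\langle\xi^\perp,\eta\rangle=\mathbb Z$, where $\langle\xi^\perp,\eta\rangle:=\{T(\chi)(\eta)\mid\chi\in\xi^\perp\}\subset\hat{\mathbb Z}$.
   Context: For $E=\mathbb C/\Lambda$, $E_{\rm tor}=\mathbb Q\Lambda/\Lambda$ and $TE=\mathrm{Hom}(\mathbb Q/\mathbb Z,E_{\rm tor})$. $T=\mathrm{Hom}(\mathbb Q/\mathbb Z,-)$ is applied to torsion subgroups; a character $\chi\in\mathrm{Hom}(E,\mathbb R/\mathbb Z)$ (continuous group homomorphism) maps $E_{\rm tor}$ to $\mathbb Q/\mathbb Z$ and gives $T(\chi):TE\to\mathrm{Hom}(\mathbb Q/\mathbb Z,\mathbb Q/\mathbb Z)=\hat{\mathbb Z}$. Define $\xi^\perp:=\{\chi\in\mathrm{Hom}(E,\mathbb R/\mathbb Z)\mid T(\chi)(\xi)=0\}$. A two-dimensional $\mathbb Q$-lattice is a pair $(\Lambda,\phi)$ with $\Lambda\subset\mathbb C$ a lattice and $\phi:\mathbb Q^2/\mathbb Z^2\to\mathbb Q\Lambda/\Lambda$ a homomorphism; $\mathbb C^\times$ acts by scaling $\lambda(\Lambda,\phi)=(\lambda\Lambda,\lambda\phi)$. A triple $(E;\xi,\eta)$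 with $E=\mathbb C/\Lambda$ corresponds to the $\mathbb Q$-lattice $(\Lambda,\phi)$, well defined up to scale, with $\phi(x,y)=\xi(x)+\eta(y)$. Use the $\mathbb R$-basis $e_1=1$, $e_2=-i$ of $\mathbb C$, on which $2\times2$ real matrices act by $\begin{pmatrix} a&b\\c&d\end{pmatrix}(xe_1+ye_2)=(ax+by)e_1+(cx+dy)e_2$, and similarly $\rho\in M_2(\hat{\mathbb Z})$ defines $\rho:\mathbb Q^2/\mathbb Z^2\to\mathbb Q\Lambda_0/\Lambda_0$ where $\Lambda_0=\mathbb Ze_1+\mathbb Ze_2$. A parabolic $\mathbb Q$-lattice is one of the form $(\alpha^{-1}\Lambda_0,\alpha^{-1}\circ\rho)$ with $\rho=\begin{pmatrix} u&v\\0&1\end{pmatrix}$, $u,v\in\hat{\mathbb Z}$, and $\alpha=\begin{pmatrix} a&b\\0&1\end{pmatrix}$, $a>0$, $b\in\mathbb R$. The map $\theta$ sends a parabolic $\mathbb Q$-lattice to its class as a $\mathbb Q$-lattice up to scale. *)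

theory Defs
  imports "HOL-Analysis.Analysis" "HOL-Algebra.Coset"
begin

section \<open>Quotients of additive groups\<close>

text \<open>
  \<open>HOL-Algebra\<close> writes groups multiplicatively, so addition of numbers appears below as the
  operation \<open>\<otimes>\<close> and zero as \<open>\<one>\<close>. Elements of a quotient are cosets; hence \<open>\<rat>/\<int>\<close> is literally a
  subset of \<open>\<real>/\<int>\<close>, and \<open>\<rat>\<Lambda>/\<Lambda>\<close> a subset of \<open>\<complex>/\<Lambda>\<close>.
\<close>

definition additive_on :: "'a::ab_group_add set \<Rightarrow> 'a monoid" where
  "additive_on S = \<lparr>carrier = S, mult = (+), one = 0\<rparr>"

abbreviation QZ :: "real set monoid" where
  "QZ \<equiv> additive_on \<rat> Mod \<int>"

abbreviation RZ :: "real set monoid" where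
  "RZ \<equiv> additive_on UNIV Mod \<int>"

text \<open>The preimage of a set \<open>U\<close> of cosets under the projection is \<open>\<Union>U\<close>.\<close>

definition quotient_top :: "'a::{ab_group_add, topological_space} set \<Rightarrow> 'a set topology" where
  "quotient_top N =
     topology (\<lambda>U. U \<subseteq> carrier (additive_on UNIV Mod N) \<and> open (\<Union>U))"

text \<open>
  Homomorphisms are made extensional so that equality of functions is equality on the carrier.
\<close>

definition Hom :: "('a, 'm) monoid_scheme \<Rightarrow> ('b, 'n) monoid_scheme \<Rightarrow> ('a \<Rightarrow> 'b) set" where
  "Hom G H = hom G H \<inter> extensional (carrier G)"

definition zero_hom :: "('a, 'm) monoid_scheme \<Rightarrow> ('b, 'n) monoid_scheme \<Rightarrow> 'a \<Rightarrow> 'b" where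
  "zero_hom G H = (\<lambda>x\<in>carrier G. \<one>\<^bsub>H\<^esub>)"

section \<open>Total Tate modules and profinite integers\<close>

definition Tate :: "('a, 'm) monoid_scheme \<Rightarrow> (real set \<Rightarrow> 'a) set" where
  "Tate G = Hom QZ G"

definition Tate_map :: "('a \<Rightarrow> 'b) \<Rightarrow> (real set \<Rightarrow> 'a) \<Rightarrow> (real set \<Rightarrow> 'b)" where
  "Tate_map f \<xi> = compose (carrier QZ) f \<xi>"

text \<open>The profinite integers, as the endomorphism ring of \<open>\<rat>/\<int>\<close>.\<close>

abbreviation Zhat :: "(real set \<Rightarrow> real set) set" where
  "Zhat \<equiv> Tate QZ"

definition Zhat_of_int :: "int \<Rightarrow> real set \<Rightarrow> real set" where
  "Zhat_of_int n = (\<lambda>x\<in>carrier QZ. x [^]\<^bsub>QZ\<^esub> n)"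

definition Zhat_zero :: "real set \<Rightarrow> real set" where
  "Zhat_zero = zero_hom QZ QZ"

definition Zhat_one :: "real set \<Rightarrow> real set" where
  "Zhat_one = (\<lambda>x\<in>carrier QZ. x)"

section \<open>Complex tori\<close>

definition complex_lattice :: "complex set \<Rightarrow> bool" where
  "complex_lattice \<Lambda> \<longleftrightarrow>
     (\<exists>w1 w2. w1 \<noteq> w2 \<and> independent {w1, w2} \<and>
        \<Lambda> = {of_int m * w1 + of_int n * w2 | m n. True})"

definition rational_span :: "complex set \<Rightarrow> complex set" where
  "rational_span \<Lambda> = {of_rat q * l | q l. l \<in> \<Lambda>}"

definition elliptic_curve :: "complex set \<Rightarrow> complex set monoid" where
  "elliptic_curve \<Lambda> = additive_on UNIV Mod \<Lambda>"

definition E_tor :: "complex set \<Rightarrow> complex set monoid" where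
  "E_tor \<Lambda> = additive_on (rational_span \<Lambda>) Mod \<Lambda>"

definition characters :: "complex set \<Rightarrow> (complex set \<Rightarrow> real set) set" where
  "characters \<Lambda> =
     {\<psi> \<in> Hom (elliptic_curve \<Lambda>) RZ. continuous_map (quotient_top \<Lambda>) (quotient_top \<int>) \<psi>}"

definition perp :: "complex set \<Rightarrow> (real set \<Rightarrow> complex set) \<Rightarrow> (complex set \<Rightarrow> real set) set" where
  "perp \<Lambda> \<xi> = {\<psi> \<in> characters \<Lambda>. Tate_map \<psi> \<xi> = Zhat_zero}"

definition perp_pairing ::
  "complex set \<Rightarrow> (real set \<Rightarrow> complex set) \<Rightarrow> (real set \<Rightarrow> complex set) \<Rightarrow>
     (real set \<Rightarrow> real set) set" where
  "perp_pairing \<Lambda> \<xi> \<eta> = {Tate_map \<psi> \<eta> | \<psi>. \<psi> \<in> perp \<Lambda> \<xi>}"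

section \<open>Two-dimensional \<open>\<rat>\<close>-lattices\<close>

text \<open>\<open>\<rat>\<^sup>2/\<int>\<^sup>2\<close>, identified with \<open>(\<rat>/\<int>)\<^sup>2\<close>.\<close>

abbreviation QZ2 :: "(real set \<times> real set) monoid" where
  "QZ2 \<equiv> QZ \<times>\<times> QZ"

type_synonym q_lattice = "complex set \<times> (real set \<times> real set \<Rightarrow> complex set)"

definition q_lattices :: "q_lattice set" where
  "q_lattices = {(\<Lambda>, \<phi>). complex_lattice \<Lambda> \<and> \<phi> \<in> Hom QZ2 (E_tor \<Lambda>)}"

text \<open>
  For an \<open>\<real>\<close>-linear bijection \<open>f\<close> of \<open>\<complex>\<close>, the induced map \<open>\<rat>\<Lambda>/\<Lambda> \<rightarrow> \<rat>f(\<Lambda>)/f(\<Lambda>)\<close> sends a coset to its image.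
\<close>

definition transport :: "(complex \<Rightarrow> complex) \<Rightarrow> q_lattice \<Rightarrow> q_lattice" where
  "transport f L = (f ` fst L, \<lambda>p\<in>carrier QZ2. f ` snd L p)"

definition up_to_scale :: "q_lattice \<Rightarrow> q_lattice set" where
  "up_to_scale L = {transport ((*) c) L | c. c \<noteq> 0}"

definition q_lattice_of ::
  "complex set \<Rightarrow> (real set \<Rightarrow> complex set) \<Rightarrow> (real set \<Rightarrow> complex set) \<Rightarrow> q_lattice" where
  "q_lattice_of \<Lambda> \<xi> \<eta> =
     (\<Lambda>, \<lambda>p\<in>carrier QZ2. \<xi> (fst p) \<otimes>\<^bsub>E_tor \<Lambda>\<^esub> \<eta> (snd p))"

section \<open>Parabolic \<open>\<rat>\<close>-lattices\<close>

definition e1 :: complex where "e1 = 1"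
definition e2 :: complex where "e2 = - \<i>"

definition \<Lambda>\<^sub>0 :: "complex set" where
  "\<Lambda>\<^sub>0 = {of_int m * e1 + of_int n * e2 | m n. True}"

text \<open>The coordinates of \<open>z\<close> in the basis \<open>e1, e2\<close> are \<open>Re z\<close> and \<open>- Im z\<close>.\<close>

definition real_mat_act :: "real \<Rightarrow> real \<Rightarrow> real \<Rightarrow> real \<Rightarrow> complex \<Rightarrow> complex" where
  "real_mat_act a b c d z =
     (let x = Re z; y = - Im z
      in of_real (a * x + b * y) * e1 + of_real (c * x + d * y) * e2)"

text \<open>For cosets \<open>X, Y\<close> of \<open>\<int>\<close>, the set \<open>X e1 + Y e2\<close> is a coset of \<open>\<Lambda>\<^sub>0\<close>.\<close>

definition basis_coset :: "real set \<Rightarrow> real set \<Rightarrow> complex set" where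
  "basis_coset X Y = {of_real x * e1 + of_real y * e2 | x y. x \<in> X \<and> y \<in> Y}"

definition Zhat_mat_hom ::
  "(real set \<Rightarrow> real set) \<Rightarrow> (real set \<Rightarrow> real set) \<Rightarrow>
   (real set \<Rightarrow> real set) \<Rightarrow> (real set \<Rightarrow> real set) \<Rightarrow>
   real set \<times> real set \<Rightarrow> complex set" where
  "Zhat_mat_hom r11 r12 r21 r22 =
     (\<lambda>p\<in>carrier QZ2.
        basis_coset (r11 (fst p) \<otimes>\<^bsub>QZ\<^esub> r12 (snd p)) (r21 (fst p) \<otimes>\<^bsub>QZ\<^esub> r22 (snd p)))"

definition parabolic_q_lattices :: "q_lattice set" where
  "parabolic_q_lattices =
     {transport (inv_into UNIV (real_mat_act a b 0 1)) (\<Lambda>\<^sub>0, Zhat_mat_hom u v Zhat_zero Zhat_one)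
      | u v a b. u \<in> Zhat \<and> v \<in> Zhat \<and> a > 0}"

definition \<theta> :: "q_lattice \<Rightarrow> q_lattice set" where
  "\<theta> L = up_to_scale L"

section \<open>Well-definedness\<close>

lemma comm_group_additive_on:
  assumes "0 \<in> S" "\<And>x y. x \<in> S \<Longrightarrow> y \<in> S \<Longrightarrow> x + y \<in> S" "\<And>x. x \<in> S \<Longrightarrow> - x \<in> S"
  shows "comm_group (additive_on S)"
proof (rule comm_groupI)
  fix x assume "x \<in> carrier (additive_on S)"
  then show "\<exists>y\<in>carrier (additive_on S). y \<otimes>\<^bsub>additive_on S\<^esub> x = \<one>\<^bsub>additive_on S\<^esub>"
    using assms by (intro bexI[of _ "- x"]) (auto simp: additive_on_def)
qed (use assms in \<open>auto simp: additive_on_def add_ac\<close>)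

lemma carrier_additive_on_Mod:
  "carrier (additive_on S Mod N) = {{n + x | n. n \<in> N} | x. x \<in> S}"
  by (auto simp: carrier_FactGroup additive_on_def r_coset_def)

lemma mult_additive_on_Mod:
  "X \<otimes>\<^bsub>additive_on S Mod N\<^esub> Y = {x + y | x y. x \<in> X \<and> y \<in> Y}"
  by (auto simp: additive_on_def set_mult_def)

lemma comm_group_additive_on_Mod:
  assumes "N \<subseteq> S"
    and "0 \<in> S" "\<And>x y. x \<in> S \<Longrightarrow> y \<in> S \<Longrightarrow> x + y \<in> S" "\<And>x. x \<in> S \<Longrightarrow> - x \<in> S"
    and "0 \<in> N" "\<And>x y. x \<in> N \<Longrightarrow> y \<in> N \<Longrightarrow> x + y \<in> N" "\<And>x. x \<in> N \<Longrightarrow> - x \<in> N"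
  shows "comm_group (additive_on S Mod N)"
proof -
  interpret comm_group "additive_on S" by (rule comm_group_additive_on) (use assms in auto)
  have inv: "inv\<^bsub>additive_on S\<^esub> x = - x" if "x \<in> N" for x
    by (rule inv_equality) (use that assms in \<open>auto simp: additive_on_def\<close>)
  have "subgroup N (additive_on S)"
    by (rule subgroupI) (use assms inv in \<open>auto simp: additive_on_def\<close>)
  then show ?thesis by (rule abelian_FactGroup)
qed

lemma comm_group_QZ: "comm_group QZ"
  by (rule comm_group_additive_on_Mod) (auto intro: Ints_subset_Rats[THEN subsetD])

lemma complex_lattice_closed:
  assumes "complex_lattice L"
  shows "0 \<in> L" "\<And>x y. x \<in> L \<Longrightarrow> y \<in> L \<Longrightarrow> x + y \<in> L" "\<And>x. x \<in> L \<Longrightarrow> - x \<in> L"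
    "\<And>x. x \<in> L \<Longrightarrow> of_int k * x \<in> L"
proof -
  obtain w1 w2 where L: "L = {of_int m * w1 + of_int n * w2 | m n. True}"
    using assms unfolding complex_lattice_def by blast
  show "0 \<in> L" unfolding L by (auto intro!: exI[of _ 0])
  show "x + y \<in> L" if "x \<in> L" "y \<in> L" for x y
  proof -
    from that obtain m n m' n' where "x = of_int m * w1 + of_int n * w2" "y = of_int m' * w1 + of_int n' * w2"
      unfolding L by blast
    then have "x + y = of_int (m+m') * w1 + of_int (n+n') * w2" by (simp add: algebra_simps)
    then show ?thesis unfolding L by blast
  qed
  show *: "of_int k * x \<in> L" if "x \<in> L" for x k
  proof -
    from that obtain m n where "x = of_int m * w1 + of_int n * w2" unfolding L by blast
    then have "of_int k * x = of_int (k*m) * w1 + of_int (k*n) * w2" by (simp add: algebra_simps)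
    then show ?thesis unfolding L by blast
  qed
  show "- x \<in> L" if "x \<in> L" for x using *[OF that, of "-1"] by simp
qed

lemma rational_span_closed:
  assumes "complex_lattice L"
  shows "L \<subseteq> rational_span L" "0 \<in> rational_span L"
    "\<And>x y. x \<in> rational_span L \<Longrightarrow> y \<in> rational_span L \<Longrightarrow> x + y \<in> rational_span L"
    "\<And>x. x \<in> rational_span L \<Longrightarrow> - x \<in> rational_span L"
proof -
  note L = complex_lattice_closed[OF assms]
  show sub: "L \<subseteq> rational_span L"
  proof
    fix l assume "l \<in> L"
    then have "l = of_rat 1 * l \<and> l \<in> L" by simp
    then show "l \<in> rational_span L" unfolding rational_span_def by blast
  qed
  then show "0 \<in> rational_span L" using L by auto
  show "- x \<in> rational_span L" if "x \<in> rational_span L" for x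
  proof -
    from that obtain q l where "x = of_rat q * l" "l \<in> L" unfolding rational_span_def by blast
    then have "- x = of_rat q * (- l)" "- l \<in> L" using L by auto
    then show ?thesis unfolding rational_span_def by blast
  qed
  show "x + y \<in> rational_span L" if "x \<in> rational_span L" "y \<in> rational_span L" for x y
  proof -
    from that obtain q l q' l' where 1: "x = of_rat q * l" "l \<in> L" "y = of_rat q' * l'" "l' \<in> L"
      unfolding rational_span_def by blast
    obtain a b where q: "q = of_int a / of_int b" "b > 0"
      by (metis Fract_of_int_quotient Rat_cases)
    obtain a' b' where q': "q' = of_int a' / of_int b'" "b' > 0"
      by (metis Fract_of_int_quotient Rat_cases)
    have "x + y = of_rat (1 / of_int (b * b')) * (of_int (a * b') * l + of_int (a' * b) * l')"
    proof -
      have "(of_rat q :: complex) = of_int a / of_int b" "(of_rat q' :: complex) = of_int a' / of_int b'"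
        "(of_rat (1 / of_int (b * b')) :: complex) = 1 / (of_int b * of_int b')"
        by (simp_all add: q(1) q'(1) of_rat_divide of_rat_mult)
      moreover have "of_int a / of_int b * l + of_int a' / of_int b' * l' =
        1 / (of_int b * of_int b') * (of_int (a * b') * l + of_int (a' * b) * l')"
        using q(2) q'(2) by (simp add: field_simps)
      ultimately show ?thesis unfolding 1 by metis
    qed
    moreover have "of_int (a * b') * l + of_int (a' * b) * l' \<in> L"
      using L 1 by blast
    ultimately show ?thesis unfolding rational_span_def by blast
  qed
qed

lemma comm_group_E_tor:
  assumes "complex_lattice L" shows "comm_group (E_tor L)"
  unfolding E_tor_def
  by (rule comm_group_additive_on_Mod)
     (use complex_lattice_closed[OF assms] rational_span_closed[OF assms] in auto)

lemma q_lattice_of_in_q_lattices: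
  assumes "complex_lattice L" "\<xi> \<in> Tate (E_tor L)" "\<eta> \<in> Tate (E_tor L)"
  shows "q_lattice_of L \<xi> \<eta> \<in> q_lattices"
proof -
  interpret E: comm_group "E_tor L" using assms comm_group_E_tor by blast
  interpret QZ: comm_group QZ by (rule comm_group_QZ)
  interpret Q2: group QZ2 by (rule DirProd_group) (rule QZ.is_group)+
  have x: "\<And>p. p \<in> carrier QZ \<Longrightarrow> \<xi> p \<in> carrier (E_tor L)" "\<And>p. p \<in> carrier QZ \<Longrightarrow> \<eta> p \<in> carrier (E_tor L)"
    "\<And>p q. p \<in> carrier QZ \<Longrightarrow> q \<in> carrier QZ \<Longrightarrow> \<xi> (p \<otimes>\<^bsub>QZ\<^esub> q) = \<xi> p \<otimes>\<^bsub>E_tor L\<^esub> \<xi> q"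
    "\<And>p q. p \<in> carrier QZ \<Longrightarrow> q \<in> carrier QZ \<Longrightarrow> \<eta> (p \<otimes>\<^bsub>QZ\<^esub> q) = \<eta> p \<otimes>\<^bsub>E_tor L\<^esub> \<eta> q"
    using assms unfolding Tate_def Hom_def hom_def by auto
  show ?thesis
    using assms(1) unfolding q_lattices_def q_lattice_of_def Hom_def hom_def
    using x QZ.m_closed
    by (auto simp del: mult_FactGroup simp: mult_DirProd' E.m_ac)
qed

lemma openin_quotient_top:
  "openin (quotient_top N) U \<longleftrightarrow> U \<subseteq> carrier (additive_on UNIV Mod N) \<and> open (\<Union>U)"
  if N: "0 \<in> N" "\<And>x y. x \<in> N \<Longrightarrow> y \<in> N \<Longrightarrow> x + y \<in> N" "\<And>x. x \<in> N \<Longrightarrow> - x \<in> N"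
proof -
  have disj: "X = Y" if "X \<in> carrier (additive_on UNIV Mod N)" "Y \<in> carrier (additive_on UNIV Mod N)"
    "z \<in> X" "z \<in> Y" for X Y and z :: 'a
  proof -
    have *: "X = {n + z | n. n \<in> N}" if Xz: "X \<in> carrier (additive_on UNIV Mod N)" "z \<in> X" for X
    proof -
      obtain x where X: "X = {n + x | n. n \<in> N}" using Xz(1) unfolding carrier_additive_on_Mod by blast
      then obtain m where m: "z = m + x" "m \<in> N" using Xz(2) by blast
      have "n + x = (n + - m) + z \<and> n + - m \<in> N" if "n \<in> N" for n
        using m that N by (auto simp: algebra_simps simp del: add_uminus_conv_diff)
      moreover have "n + z = (n + m) + x \<and> n + m \<in> N" if "n \<in> N" for n
        using m that N by (auto simp: algebra_simps)
      ultimately show ?thesis unfolding X by blast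
    qed
    show ?thesis using *[of X] *[of Y] that by simp
  qed
  have "istopology (\<lambda>U. U \<subseteq> carrier (additive_on UNIV Mod N) \<and> open (\<Union>U))"
    unfolding istopology_def
  proof (intro conjI allI impI; (elim conjE)?)
    fix S T assume S: "S \<subseteq> carrier (additive_on UNIV Mod N)" "open (\<Union>S)"
      and T: "T \<subseteq> carrier (additive_on UNIV Mod N)" "open (\<Union>T)"
    have "\<Union>(S \<inter> T) = \<Union>S \<inter> \<Union>T" using S T disj by blast
    then show "open (\<Union>(S \<inter> T))" using S T by auto
  next
    fix K assume "\<forall>S\<in>K. S \<subseteq> carrier (additive_on UNIV Mod N) \<and> open (\<Union>S)"
    moreover have "\<Union>(\<Union>K) = (\<Union>S\<in>K. \<Union>S)" by blast
    ultimately show "open (\<Union>(\<Union>K))" by (metis (no_types, lifting) open_UN)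
  qed auto
  then show ?thesis unfolding quotient_top_def by (simp add: topology_inverse')
qed

lemma real_mat_act_inverse:
  assumes "a \<noteq> 0"
  shows "real_mat_act a b 0 1 (real_mat_act (1/a) (-b/a) 0 1 z) = z"
   "real_mat_act (1/a) (-b/a) 0 1 (real_mat_act a b 0 1 z) = z"
  using assms by (auto simp: real_mat_act_def e1_def e2_def Let_def complex_eq_iff field_simps)

lemma inv_real_mat_act:
  assumes "a \<noteq> 0"
  shows "inv_into UNIV (real_mat_act a b 0 1) = real_mat_act (1/a) (-b/a) 0 1"
  using inv_unique_comp[of "real_mat_act a b 0 1" "real_mat_act (1/a) (-b/a) 0 1"] real_mat_act_inverse[OF assms]
  by (auto simp: fun_eq_iff)


lemma quotient_map_quotient_top:
  assumes N: "0 \<in> N" "\<And>x y. x \<in> N \<Longrightarrow> y \<in> N \<Longrightarrow> x + y \<in> N" "\<And>x. x \<in> N \<Longrightarrow> - x \<in> N"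
  shows "quotient_map euclidean (quotient_top N) (\<lambda>z. {n + z | n. n \<in> N})"
proof -
  let ?\<pi> = "\<lambda>z. {n + z | n. n \<in> N}"
  have car: "carrier (additive_on UNIV Mod N) = range ?\<pi>"
    unfolding carrier_additive_on_Mod by blast
  have ran: "openin (quotient_top N) U \<longleftrightarrow> U \<subseteq> range ?\<pi> \<and> open (\<Union>U)" for U
    using openin_quotient_top[OF N] car by simp
  have pre: "{z. ?\<pi> z \<in> U} = \<Union>U" if U: "U \<subseteq> range ?\<pi>" for U
  proof
    show "{z. ?\<pi> z \<in> U} \<subseteq> \<Union>U"
    proof
      fix z assume "z \<in> {z. ?\<pi> z \<in> U}"
      moreover have "z \<in> ?\<pi> z" using N(1) by (auto intro!: exI[of _ 0])
      ultimately show "z \<in> \<Union>U" by blast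
    qed
    show "\<Union>U \<subseteq> {z. ?\<pi> z \<in> U}"
    proof
      fix z assume "z \<in> \<Union>U"
      then obtain x where x: "z \<in> ?\<pi> x" "?\<pi> x \<in> U" using U by blast
      then obtain m where m: "z = m + x" "m \<in> N" by blast
      have "n + x = (n + - m) + z \<and> n + - m \<in> N" if "n \<in> N" for n
        using m that N by (auto simp: algebra_simps simp del: add_uminus_conv_diff)
      moreover have "n + z = (n + m) + x \<and> n + m \<in> N" if "n \<in> N" for n
        using m that N by (auto simp: algebra_simps)
      ultimately have "?\<pi> z = ?\<pi> x" by blast
      then show "z \<in> {z. ?\<pi> z \<in> U}" using x by simp
    qed
  qed
  have top: "topspace (quotient_top N) = range ?\<pi>"
  proof -
    have "\<Union>(range ?\<pi>) = UNIV" using pre[of "range ?\<pi>"] by simp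
    then have "openin (quotient_top N) (range ?\<pi>)" unfolding ran by simp
    then have "range ?\<pi> \<subseteq> topspace (quotient_top N)" by (rule openin_subset)
    moreover have "topspace (quotient_top N) \<subseteq> range ?\<pi>"
      using openin_topspace[of "quotient_top N"] unfolding ran by (rule conjunct1)
    ultimately show ?thesis by (rule subset_antisym[rotated])
  qed
  show ?thesis
    unfolding quotient_map_def top
  proof (intro conjI allI impI)
    fix U assume U: "U \<subseteq> range ?\<pi>"
    have "{z \<in> topspace euclidean. ?\<pi> z \<in> U} = \<Union>U" using pre[OF U] by simp
    then show "openin euclidean {z \<in> topspace euclidean. ?\<pi> z \<in> U} \<longleftrightarrow> openin (quotient_top N) U"
      using U unfolding ran by simp
  qed simp
qed

lemma of_real_of_rat: "(of_real (of_rat q) :: complex) = of_rat q"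
proof -
  obtain a b where q: "q = of_int a / of_int b" by (metis Fract_of_int_quotient Rat_cases)
  show ?thesis by (simp add: q of_rat_divide)
qed

lemma transport_in_q_lattices:
  assumes f: "linear f" "inj f" and L: "L \<in> q_lattices"
  shows "transport f L \<in> q_lattices"
proof -
  obtain \<Lambda> \<phi> where L': "L = (\<Lambda>, \<phi>)" "complex_lattice \<Lambda>" "\<phi> \<in> Hom QZ2 (E_tor \<Lambda>)"
    using L unfolding q_lattices_def by blast
  obtain w1 w2 where w: "w1 \<noteq> w2" "independent {w1, w2}"
    "\<Lambda> = {of_int m * w1 + of_int n * w2 | m n. True}"
    using L'(2) unfolding complex_lattice_def by blast
  have add: "f (x + y) = f x + f y" for x y using f(1) by (simp add: linear_add)
  have sc: "f (of_real r * x) = of_real r * f x" for r x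
    using linear_scale[OF f(1), of r x] by (simp add: scaleR_conv_of_real)
  have scint: "f (of_int m * x) = of_int m * f x" for m x using sc[of "of_int m"] by simp
  have scrat: "f (of_rat q * x) = of_rat q * f x" for q x
    using sc[of "of_rat q"] by (simp add: of_real_of_rat)
  have "f ` \<Lambda> = {of_int m * f w1 + of_int n * f w2 | m n. True}"
    unfolding w(3) by (force simp: add scint)
  moreover have "independent {f w1, f w2}"
    using linear_independent_injective_image[OF f(1) w(2)] f(2) inj_on_subset by force
  ultimately have 1: "complex_lattice (f ` \<Lambda>)"
    unfolding complex_lattice_def
    by (intro exI[of _ "f w1"] exI[of _ "f w2"]) (use w(1) f(2) in \<open>auto dest: injD\<close>)
  have rs: "rational_span (f ` \<Lambda>) = f ` rational_span \<Lambda>"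
    unfolding rational_span_def by (force simp: scrat)
  have "f ` X \<in> carrier (E_tor (f ` \<Lambda>))" if XE: "X \<in> carrier (E_tor \<Lambda>)" for X
  proof -
    obtain x where "X = {n + x | n. n \<in> \<Lambda>}" "x \<in> rational_span \<Lambda>"
      using XE unfolding E_tor_def carrier_additive_on_Mod by blast
    then have "f ` X = {n + f x | n. n \<in> f ` \<Lambda>}" "f x \<in> rational_span (f ` \<Lambda>)"
      unfolding rs by (force simp: add)+
    then show ?thesis unfolding E_tor_def carrier_additive_on_Mod by blast
  qed
  moreover have "f ` (X \<otimes>\<^bsub>E_tor \<Lambda>\<^esub> Y) = f ` X \<otimes>\<^bsub>E_tor (f ` \<Lambda>)\<^esub> f ` Y" for X Y
    unfolding E_tor_def mult_additive_on_Mod by (force simp: add)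
  moreover interpret QZ: comm_group QZ by (rule comm_group_QZ)
  interpret Q2: group QZ2 by (rule DirProd_group) (rule QZ.is_group)+
  have "x \<otimes>\<^bsub>QZ2\<^esub> y \<in> carrier QZ2" if "x \<in> carrier QZ2" "y \<in> carrier QZ2" for x y
    using that by (rule Q2.m_closed)
  ultimately have "(\<lambda>p\<in>carrier QZ2. f ` \<phi> p) \<in> Hom QZ2 (E_tor (f ` \<Lambda>))"
    using L'(3) unfolding Hom_def hom_def by (auto simp: Pi_iff simp del: mult_FactGroup carrier_DirProd mult_DirProd)
  then show ?thesis using 1 unfolding L' q_lattices_def transport_def by simp
qed

lemma lattice0: "complex_lattice \<Lambda>\<^sub>0"
proof -
  have "independent {e1, e2}"
    unfolding independent_insert by (auto simp: independent_empty e1_def e2_def span_singleton complex_eq_iff)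
  moreover have "e1 \<noteq> e2" by (auto simp: e1_def e2_def complex_eq_iff)
  ultimately show ?thesis unfolding complex_lattice_def \<Lambda>\<^sub>0_def by blast
qed

lemma basis_coset_closed:
  assumes "X \<in> carrier QZ" "Y \<in> carrier QZ"
  shows "basis_coset X Y \<in> carrier (E_tor \<Lambda>\<^sub>0)"
proof -
  obtain x y where X: "X = {n + x | n. n \<in> \<int>}" "x \<in> \<rat>" "Y = {n + y | n. n \<in> \<int>}" "y \<in> \<rat>"
    using assms unfolding carrier_additive_on_Mod by blast
  obtain p q where pq: "x = of_rat p" "y = of_rat q" using X by (metis Rats_cases)
  have z: "of_int m * e1 + of_int n * e2 \<in> \<Lambda>\<^sub>0" for m n unfolding \<Lambda>\<^sub>0_def by blast
  have "of_rat p * e1 \<in> rational_span \<Lambda>\<^sub>0" "of_rat q * e2 \<in> rational_span \<Lambda>\<^sub>0"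
    unfolding rational_span_def using z[of 1 0] z[of 0 1] by auto
  then have "of_real x * e1 + of_real y * e2 \<in> rational_span \<Lambda>\<^sub>0"
    using rational_span_closed(3)[OF lattice0] pq by (metis of_real_of_rat)
  moreover have "basis_coset X Y = {n + (of_real x * e1 + of_real y * e2) | n. n \<in> \<Lambda>\<^sub>0}"
  proof (intro equalityI subsetI)
    fix w assume "w \<in> basis_coset X Y"
    then obtain m n where "w = of_real (of_int m + x) * e1 + of_real (of_int n + y) * e2"
      unfolding basis_coset_def X by (auto elim!: Ints_cases)
    then have "w = (of_int m * e1 + of_int n * e2) + (of_real x * e1 + of_real y * e2)"
      by (simp add: algebra_simps)
    then show "w \<in> {n + (of_real x * e1 + of_real y * e2) | n. n \<in> \<Lambda>\<^sub>0}" using z by blast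
  next
    fix w assume "w \<in> {n + (of_real x * e1 + of_real y * e2) | n. n \<in> \<Lambda>\<^sub>0}"
    then obtain m n where "w = of_int m * e1 + of_int n * e2 + (of_real x * e1 + of_real y * e2)"
      unfolding \<Lambda>\<^sub>0_def by blast
    then have "w = of_real (of_int m + x) * e1 + of_real (of_int n + y) * e2"
      by (simp add: algebra_simps)
    moreover have "of_int m + x \<in> X" "of_int n + y \<in> Y" unfolding X by auto
    ultimately show "w \<in> basis_coset X Y" unfolding basis_coset_def by blast
  qed
  ultimately show ?thesis unfolding E_tor_def carrier_additive_on_Mod by blast
qed

lemma basis_coset_mult:
  "basis_coset (X \<otimes>\<^bsub>QZ\<^esub> X') (Y \<otimes>\<^bsub>QZ\<^esub> Y') = basis_coset X Y \<otimes>\<^bsub>E_tor \<Lambda>\<^sub>0\<^esub> basis_coset X' Y'"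
proof -
  have *: "of_real (x + x') * e1 + of_real (y + y') * e2 = (of_real x * e1 + of_real y * e2) + (of_real x' * e1 + of_real y' * e2)"
    for x x' y y' by (simp add: algebra_simps)
  show ?thesis unfolding E_tor_def mult_additive_on_Mod basis_coset_def
  proof (intro equalityI subsetI; clarify)
    fix x y a b assume "a \<in> X" "b \<in> X'" "x \<in> Y" "y \<in> Y'"
    then show "\<exists>xa ya. of_real (a + b) * e1 + of_real (x + y) * e2 = xa + ya \<and>
       xa \<in> {of_real x * e1 + of_real y * e2 |x y. x \<in> X \<and> y \<in> Y} \<and>
       ya \<in> {of_real x * e1 + of_real y * e2 |x y. x \<in> X' \<and> y \<in> Y'}" using * by blast
  next
    fix x y x' y' assume "x \<in> X" "y \<in> Y" "x' \<in> X'" "y' \<in> Y'"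
    then show "\<exists>xa ya. of_real x * e1 + of_real y * e2 + (of_real x' * e1 + of_real y' * e2) = of_real xa * e1 + of_real ya * e2 \<and>
       xa \<in> {x + y |x y. x \<in> X \<and> y \<in> X'} \<and> ya \<in> {x + y |x y. x \<in> Y \<and> y \<in> Y'}"
      by (intro exI[of _ "x + x'"] exI[of _ "y + y'"]) (use * in auto)
  qed
qed

lemma parabolic_subset: "parabolic_q_lattices \<subseteq> q_lattices"
proof
  fix L assume "L \<in> parabolic_q_lattices"
  then obtain u v a b where L: "u \<in> Zhat" "v \<in> Zhat" "a > 0"
    "L = transport (inv_into UNIV (real_mat_act a b 0 1)) (\<Lambda>\<^sub>0, Zhat_mat_hom u v Zhat_zero Zhat_one)"
    unfolding parabolic_q_lattices_def by blast
  interpret QZ: comm_group QZ by (rule comm_group_QZ)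
  interpret Q2: group QZ2 by (rule DirProd_group) (rule QZ.is_group)+
  have e: "Zhat_zero \<in> Zhat" "Zhat_one \<in> Zhat"
    by (auto simp: Zhat_zero_def Zhat_one_def zero_hom_def Tate_def Hom_def hom_def simp del: mult_FactGroup one_FactGroup)
  have "Zhat_mat_hom u v r s \<in> Hom QZ2 (E_tor \<Lambda>\<^sub>0)" if "r \<in> Zhat" "s \<in> Zhat" for r s
    using L(1,2) that unfolding Zhat_mat_hom_def Tate_def Hom_def hom_def
    by (auto simp: basis_coset_mult[symmetric] mult_DirProd' Pi_iff QZ.m_ac simp del: mult_FactGroup intro!: basis_coset_closed)
  then have 1: "(\<Lambda>\<^sub>0, Zhat_mat_hom u v Zhat_zero Zhat_one) \<in> q_lattices"
    using e lattice0 unfolding q_lattices_def by blast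
  have "linear (real_mat_act (1/a) (-b/a) 0 1)"
    by (rule linearI) (auto simp: real_mat_act_def Let_def complex_eq_iff e1_def e2_def algebra_simps add_divide_distrib diff_divide_distrib)
  moreover have "inj (real_mat_act (1/a) (-b/a) 0 1)"
    using real_mat_act_inverse(1)[of a b] L(3) by (metis injI less_irrefl)
  ultimately show "L \<in> q_lattices"
    unfolding L(4) using 1 inv_real_mat_act[of a b] L(3) by (auto intro: transport_in_q_lattices)
qed

end

theory Submission
  imports Defs
begin

text \<open>
  Both sides of the equivalence say that some character \<open>\<psi>\<close> of \<open>E\<close> satisfies \<open>T(\<psi>)(\<xi>) = 0\<close> and
  \<open>T(\<psi>)(\<eta>) = 1\<close>.

  Characters of \<open>E = \<complex>/\<Lambda>\<close> are the real linear forms that are integral on \<open>\<Lambda>\<close>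
  (\<open>linear_of_character\<close>, \<open>character_of_linear\<close>), so they form a free group of rank two. A character
  that pairs with \<open>\<eta>\<close> to \<open>1\<close> is primitive in this group, because \<open>1\<close> is divisible by no integer \<open>d > 1\<close> in
  the profinite integers (\<open>coprime_of_pairing_one\<close>). It is therefore the second coordinate of a basis
  \<open>w1, w2\<close> of \<open>\<Lambda>\<close>, and the sign of \<open>w1\<close> can be chosen so that the basis is oriented like \<open>e1, e2\<close>
  (\<open>adapted_basis\<close>).

  A negatively oriented basis is exactly a pair \<open>(c \<alpha>\<^sup>-\<^sup>1 e1, c \<alpha>\<^sup>-\<^sup>1 e2)\<close> with \<open>c \<noteq> 0\<close> complex and \<open>\<alpha>\<close> as in the
  definition of parabolic lattices. So the lattice of \<open>(E; \<xi>, \<eta>)\<close> is parabolic up to scale if and only if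
  \<open>\<xi> = u w1\<close> and \<open>\<eta> = v w1 + w2\<close> in such a basis, that is, if and only if the second coordinate is the
  required \<open>\<psi>\<close> (\<open>parabolic_up_to_scale_iff_pairing_one\<close>).

  On the other side, if \<open>\<langle>\<xi>\<^sup>\<bottom>, \<eta>\<rangle> = \<int>\<close> then some \<open>\<psi>\<close> in \<open>\<xi>\<^sup>\<bottom>\<close> pairs to \<open>1\<close>. Conversely, such a \<open>\<psi>\<close> generates
  \<open>\<xi>\<^sup>\<bottom>\<close>: since \<open>\<xi> = u w1\<close> is nonzero and \<open>TE\<close> is torsion free, a character that kills \<open>\<xi>\<close> vanishes at
  \<open>w1\<close> and is a multiple of \<open>\<psi>\<close> (\<open>perp_pairing_eq_Ints_iff\<close>).
\<close>

section \<open>Cosets and their images\<close>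

definition add_subgroup :: "'a::ab_group_add set \<Rightarrow> bool" where
  "add_subgroup N \<longleftrightarrow> 0 \<in> N \<and> (\<forall>x\<in>N. \<forall>y\<in>N. x + y \<in> N) \<and> (\<forall>x\<in>N. - x \<in> N)"

definition coset_of :: "'a::ab_group_add set \<Rightarrow> 'a \<Rightarrow> 'a set" where
  "coset_of N x = {n + x | n. n \<in> N}"

text \<open>
  If \<open>f\<close> is additive and maps \<open>N\<close> into \<open>M\<close>, this is the homomorphism from \<open>N\<close>-cosets to
  \<open>M\<close>-cosets induced by \<open>f\<close>. Summing with \<open>M\<close> is what makes the image of a coset a full coset, since
  \<open>f\<close> need not map \<open>N\<close> onto \<open>M\<close>.
\<close>

definition induced_map :: "'b::ab_group_add set \<Rightarrow> ('a \<Rightarrow> 'b) \<Rightarrow> 'a set \<Rightarrow> 'b set" where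
  "induced_map M f K = {m + f k | m k. m \<in> M \<and> k \<in> K}"

lemma add_subgroup_Ints: "add_subgroup (\<int> :: real set)"
  by (auto simp: add_subgroup_def)

lemma add_subgroup_lattice: "complex_lattice \<Lambda> \<Longrightarrow> add_subgroup \<Lambda>"
  using complex_lattice_closed unfolding add_subgroup_def by blast

lemma carrier_Mod: "carrier (additive_on S Mod N) = coset_of N ` S"
  unfolding carrier_additive_on_Mod coset_of_def by blast

lemma carrier_QZ: "carrier QZ = coset_of \<int> ` \<rat>"
  by (rule carrier_Mod)

lemma carrier_elliptic_curve: "carrier (elliptic_curve \<Lambda>) = range (coset_of \<Lambda>)"
  unfolding elliptic_curve_def by (rule carrier_Mod)

lemma coset_of_eq_iff:
  assumes "add_subgroup N"
  shows "coset_of N x = coset_of N y \<longleftrightarrow> x - y \<in> N"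
proof
  assume "coset_of N x = coset_of N y"
  moreover have "x \<in> coset_of N x"
    using assms unfolding coset_of_def add_subgroup_def by force
  ultimately show "x - y \<in> N" unfolding coset_of_def by auto
next
  assume d: "x - y \<in> N"
  have sub: "coset_of N x \<subseteq> coset_of N y" if "x - y \<in> N" for x y
  proof
    fix z assume "z \<in> coset_of N x"
    then obtain n where n: "n \<in> N" "z = n + x" unfolding coset_of_def by blast
    have "z = (n + (x - y)) + y" using n by simp
    moreover have "n + (x - y) \<in> N" using n that assms unfolding add_subgroup_def by blast
    ultimately show "z \<in> coset_of N y" unfolding coset_of_def by blast
  qed
  have "y - x \<in> N" using d assms unfolding add_subgroup_def by (metis minus_diff_eq)
  with d sub show "coset_of N x = coset_of N y" by blast
qed

lemma coset_of_0: "coset_of N 0 = N"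
  by (simp add: coset_of_def)

lemma coset_of_eq_self_iff: "add_subgroup N \<Longrightarrow> coset_of N x = N \<longleftrightarrow> x \<in> N"
  using coset_of_eq_iff[of N x 0] by (simp add: coset_of_0)

lemma coset_of_mult:
  assumes "add_subgroup N"
  shows "coset_of N x \<otimes>\<^bsub>additive_on S Mod N\<^esub> coset_of N y = coset_of N (x + y)"
proof -
  have "\<exists>n. n + (x + y) = (a + x) + (b + y) \<and> n \<in> N" if "a \<in> N" "b \<in> N" for a b
    using that assms by (intro exI[of _ "a + b"]) (auto simp: add_subgroup_def algebra_simps)
  moreover have "n + (x + y) = (n + x) + (0 + y) \<and> 0 \<in> N" for n
    using assms by (auto simp: add_subgroup_def algebra_simps)
  ultimately show ?thesis
    unfolding mult_additive_on_Mod coset_of_def by (fastforce)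
qed

lemma induced_map_coset:
  assumes M: "add_subgroup M" and N: "0 \<in> N" "f ` N \<subseteq> M" and f: "\<And>x y. f (x + y) = f x + f y"
  shows "induced_map M f (coset_of N x) = coset_of M (f x)"
proof -
  have "m + f (n + x) = (m + f n) + f x \<and> m + f n \<in> M" if "m \<in> M" "n \<in> N" for m n
    using that M N(2) by (auto simp: f add_subgroup_def algebra_simps)
  moreover have "m + f x = m + f (0 + x)" for m by simp
  ultimately show ?thesis
    unfolding induced_map_def coset_of_def using N(1) by blast
qed

section \<open>Homomorphisms out of \<open>\<rat>/\<int>\<close>\<close>

lemma Tate_mult:
  assumes "\<xi> \<in> Tate G" "q \<in> \<rat>" "r \<in> \<rat>"
  shows "\<xi> (coset_of \<int> (q + r)) = \<xi> (coset_of \<int> q) \<otimes>\<^bsub>G\<^esub> \<xi> (coset_of \<int> r)"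
  using assms hom_mult[of \<xi> QZ G "coset_of \<int> q" "coset_of \<int> r"]
  by (simp add: Tate_def Hom_def carrier_QZ coset_of_mult add_subgroup_Ints del: mult_FactGroup)

lemma Tate_closed: "\<xi> \<in> Tate G \<Longrightarrow> p \<in> carrier QZ \<Longrightarrow> \<xi> p \<in> carrier G"
  by (auto simp: Tate_def Hom_def hom_def)

lemma Tate_coset:
  assumes "\<xi> \<in> Tate (additive_on S Mod N)" "q \<in> \<rat>"
  obtains s where "s \<in> S" "\<xi> (coset_of \<int> q) = coset_of N s"
  using Tate_closed[OF assms(1), of "coset_of \<int> q"] assms(2)
  by (auto simp: carrier_QZ carrier_Mod)

lemma Tate_ext: "\<xi> \<in> Tate G \<Longrightarrow> \<xi> \<in> extensional (carrier QZ)"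
  by (simp add: Tate_def Hom_def)

lemma TateI:
  assumes "\<And>p. p \<in> carrier QZ \<Longrightarrow> \<xi> p \<in> carrier G" "\<xi> \<in> extensional (carrier QZ)"
    and "\<And>q r. q \<in> \<rat> \<Longrightarrow> r \<in> \<rat> \<Longrightarrow>
           \<xi> (coset_of \<int> (q + r)) = \<xi> (coset_of \<int> q) \<otimes>\<^bsub>G\<^esub> \<xi> (coset_of \<int> r)"
  shows "\<xi> \<in> Tate G"
  using assms
  by (auto simp: Tate_def Hom_def hom_def carrier_QZ coset_of_mult add_subgroup_Ints simp del: mult_FactGroup)

lemma Tate_0:
  assumes N: "add_subgroup N" and \<xi>: "\<xi> \<in> Tate (additive_on S Mod N)"
  shows "\<xi> (coset_of \<int> 0) = coset_of N 0"
proof -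
  obtain s where s: "\<xi> (coset_of \<int> 0) = coset_of N s"
    using Tate_coset[OF \<xi>, of 0] by auto
  have "coset_of N s = coset_of N (s + s)"
    using Tate_mult[OF \<xi>, of 0 0] N by (simp add: s coset_of_mult del: mult_FactGroup)
  then have "s \<in> N" using N by (auto simp: coset_of_eq_iff add_subgroup_def)
  then show ?thesis using N s by (simp add: coset_of_eq_iff)
qed

text \<open>
  Every point of \<open>\<rat>/\<int>\<close> is a \<open>k\<close>-th multiple for each \<open>k \<noteq> 0\<close>, so this rule computes any value from
  the value at a point with \<open>k\<close> times the denominator. All arguments below that rest on \<open>TE\<close> being
  torsion free or on \<open>1\<close> being indivisible in the profinite integers go through it.
\<close>

lemma Tate_int_multiple:
  fixes z :: "'a::ring_1"
  assumes N: "add_subgroup N" and \<xi>: "\<xi> \<in> Tate (additive_on S Mod N)"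
    and q: "q \<in> \<rat>" "\<xi> (coset_of \<int> q) = coset_of N z"
  shows "\<xi> (coset_of \<int> (of_int k * q)) = coset_of N (of_int k * z)"
proof -
  have zero: "\<xi> (coset_of \<int> 0) = coset_of N 0" by (rule Tate_0[OF N \<xi>])
  have step: "\<xi> (coset_of \<int> (r + q)) = coset_of N (w + z)"
    if "\<xi> (coset_of \<int> r) = coset_of N w" "r \<in> \<rat>" for r w
    using Tate_mult[OF \<xi>, of r q] that N q by (simp add: coset_of_mult del: mult_FactGroup)
  have step': "\<xi> (coset_of \<int> (r - q)) = coset_of N (w - z)"
    if w: "\<xi> (coset_of \<int> r) = coset_of N w" "r \<in> \<rat>" for r w
  proof -
    obtain s where s: "\<xi> (coset_of \<int> (r - q)) = coset_of N s"
      using Tate_coset[OF \<xi> Rats_diff[OF w(2) q(1)]] by metis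
    have "coset_of N (s + z) = coset_of N w"
      using step[OF s] w q by simp
    then show ?thesis using N s by (simp add: coset_of_eq_iff algebra_simps)
  qed
  show ?thesis
  proof (induction k rule: int_induct[where k = 0])
    case base then show ?case using zero by simp
  next
    case (step1 i) then show ?case using step[OF step1(2)] q by (simp add: algebra_simps)
  next
    case (step2 i) then show ?case using step'[OF step2(2)] q by (simp add: algebra_simps)
  qed
qed

lemma Tate_induced_map:
  assumes \<xi>: "\<xi> \<in> Tate (additive_on S Mod N)" and N: "add_subgroup N" and M: "add_subgroup M"
    and f: "\<And>x y. f (x + y) = f x + f y" "f ` N \<subseteq> M" "f ` S \<subseteq> T"
  shows "(\<lambda>p\<in>carrier QZ. induced_map M f (\<xi> p)) \<in> Tate (additive_on T Mod M)"
proof (rule TateI)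
  have ind: "induced_map M f (coset_of N x) = coset_of M (f x)" for x
    using induced_map_coset[of M N f, OF M _ f(2,1)] N by (simp add: add_subgroup_def)
  show "(\<lambda>p\<in>carrier QZ. induced_map M f (\<xi> p)) p \<in> carrier (additive_on T Mod M)"
    if p: "p \<in> carrier QZ" for p
  proof -
    obtain q where q: "q \<in> \<rat>" "p = coset_of \<int> q" using p unfolding carrier_QZ by blast
    obtain s where "s \<in> S" "\<xi> p = coset_of N s" using Tate_coset[OF \<xi> q(1)] q(2) by blast
    then show ?thesis using p f(3) by (auto simp: ind carrier_Mod)
  qed
  fix q r :: real assume q: "q \<in> \<rat>" "r \<in> \<rat>"
  obtain s t where st: "\<xi> (coset_of \<int> q) = coset_of N s" "\<xi> (coset_of \<int> r) = coset_of N t"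
    using Tate_coset[OF \<xi> q(1)] Tate_coset[OF \<xi> q(2)] by metis
  have "\<xi> (coset_of \<int> (q + r)) = coset_of N (s + t)"
    using Tate_mult[OF \<xi> q] by (simp add: st coset_of_mult[OF N] del: mult_FactGroup)
  moreover have "coset_of \<int> q \<in> carrier QZ" "coset_of \<int> r \<in> carrier QZ" "coset_of \<int> (q + r) \<in> carrier QZ"
    using q by (auto simp: carrier_QZ)
  ultimately show "(\<lambda>p\<in>carrier QZ. induced_map M f (\<xi> p)) (coset_of \<int> (q + r)) =
      (\<lambda>p\<in>carrier QZ. induced_map M f (\<xi> p)) (coset_of \<int> q) \<otimes>\<^bsub>additive_on T Mod M\<^esub>
      (\<lambda>p\<in>carrier QZ. induced_map M f (\<xi> p)) (coset_of \<int> r)"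
    by (simp add: st ind coset_of_mult[OF M] f(1) del: mult_FactGroup)
qed auto

lemma Zhat_of_int_coset:
  assumes q: "q \<in> \<rat>"
  shows "Zhat_of_int k (coset_of \<int> q) = coset_of \<int> (of_int k * q)"
proof -
  interpret QZ: comm_group QZ by (rule comm_group_QZ)
  have car: "coset_of \<int> r \<in> carrier QZ" if "r \<in> \<rat>" for r using that by (auto simp: carrier_QZ)
  have "coset_of \<int> q [^]\<^bsub>QZ\<^esub> k = coset_of \<int> (of_int k * q)"
  proof (induction k rule: int_induct[where k = 0])
    case base show ?case by (simp add: coset_of_0)
  next
    case (step1 i)
    have "coset_of \<int> q [^]\<^bsub>QZ\<^esub> (i + 1) = coset_of \<int> q [^]\<^bsub>QZ\<^esub> i \<otimes>\<^bsub>QZ\<^esub> coset_of \<int> q"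
      using QZ.int_pow_mult[OF car[OF q], of i 1] QZ.int_pow_1[OF car[OF q]] by simp
    then show ?case using step1 by (simp add: coset_of_mult add_subgroup_Ints algebra_simps del: mult_FactGroup)
  next
    case (step2 i)
    have "inv\<^bsub>QZ\<^esub> (coset_of \<int> q) = coset_of \<int> (- q)"
      by (rule QZ.inv_equality)
        (use q car in \<open>auto simp: coset_of_mult add_subgroup_Ints coset_of_0 simp del: mult_FactGroup\<close>)
    then have "coset_of \<int> q [^]\<^bsub>QZ\<^esub> (i - 1) = coset_of \<int> q [^]\<^bsub>QZ\<^esub> i \<otimes>\<^bsub>QZ\<^esub> coset_of \<int> (- q)"
      using QZ.int_pow_diff[OF car[OF q], of i 1] QZ.int_pow_1[OF car[OF q]] by simp
    then show ?case using step2 by (simp add: coset_of_mult add_subgroup_Ints algebra_simps del: mult_FactGroup)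
  qed
  then show ?thesis using car[OF q] by (simp add: Zhat_of_int_def)
qed

lemma Zhat_of_int_1: "Zhat_of_int 1 = Zhat_one"
  by (rule extensionalityI[of _ "carrier QZ"])
    (auto simp: Zhat_of_int_coset carrier_QZ, auto simp: Zhat_of_int_def Zhat_one_def carrier_QZ)

lemma Tate_map_apply: "p \<in> carrier QZ \<Longrightarrow> Tate_map \<psi> \<xi> p = \<psi> (\<xi> p)"
  by (simp add: Tate_map_def compose_def)

lemma Tate_map_eq_iff:
  assumes "f \<in> extensional (carrier QZ)"
  shows "Tate_map \<psi> \<xi> = f \<longleftrightarrow> (\<forall>q\<in>\<rat>. \<psi> (\<xi> (coset_of \<int> q)) = f (coset_of \<int> q))"
proof
  show "\<forall>q\<in>\<rat>. \<psi> (\<xi> (coset_of \<int> q)) = f (coset_of \<int> q)" if "Tate_map \<psi> \<xi> = f"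
    unfolding that[symmetric] by (auto simp: Tate_map_apply carrier_QZ)
  show "Tate_map \<psi> \<xi> = f" if "\<forall>q\<in>\<rat>. \<psi> (\<xi> (coset_of \<int> q)) = f (coset_of \<int> q)"
    by (rule extensionalityI[of _ "carrier QZ"])
      (use that assms in \<open>auto simp: carrier_QZ Tate_map_def compose_def\<close>)
qed

lemma Tate_map_eq_Zhat_zero_iff:
  "Tate_map \<psi> \<xi> = Zhat_zero \<longleftrightarrow> (\<forall>q\<in>\<rat>. \<psi> (\<xi> (coset_of \<int> q)) = coset_of \<int> 0)"
  by (subst Tate_map_eq_iff) (auto simp: Zhat_zero_def zero_hom_def carrier_QZ coset_of_0)

lemma Tate_map_eq_Zhat_one_iff:
  "Tate_map \<psi> \<xi> = Zhat_one \<longleftrightarrow> (\<forall>q\<in>\<rat>. \<psi> (\<xi> (coset_of \<int> q)) = coset_of \<int> q)"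
  by (subst Tate_map_eq_iff) (auto simp: Zhat_one_def carrier_QZ)

lemma Tate_map_eq_Zhat_of_int_iff:
  "Tate_map \<psi> \<xi> = Zhat_of_int k \<longleftrightarrow>
     (\<forall>q\<in>\<rat>. \<psi> (\<xi> (coset_of \<int> q)) = coset_of \<int> (of_int k * q))"
  by (subst Tate_map_eq_iff) (auto simp: Zhat_of_int_coset, simp add: Zhat_of_int_def)

section \<open>Continuous characters of a complex torus\<close>

text \<open>
  Additivity gives homogeneity for rational scalars, and continuity extends it to the closure of
  \<open>\<rat>\<close> in \<open>\<real>\<close>.
\<close>

lemma continuous_additive_imp_linear:
  fixes g :: "'a::real_normed_vector \<Rightarrow> real"
  assumes cont: "continuous_on UNIV g" and add: "\<And>x y. g (x + y) = g x + g y"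
  shows "linear g"
proof (rule linearI)
  fix r :: real and x
  interpret additive g by standard (rule add)
  have nat_mult: "g (of_nat n *\<^sub>R y) = of_nat n * g y" for n y
    by (induction n) (simp_all add: zero add algebra_simps)
  have int_mult: "g (of_int n *\<^sub>R y) = of_int n * g y" for n y
    by (cases n rule: int_cases2) (simp_all add: nat_mult minus)
  let ?S = "{r. g (r *\<^sub>R x) = r * g x}"
  have "q \<in> ?S" if q: "q \<in> \<rat>" for q
  proof -
    obtain a b :: int where ab: "q = of_int a / of_int b" "b \<noteq> 0"
      using q by (metis Rats_cases' less_irrefl)
    have "of_int b * g (q *\<^sub>R x) = g (of_int a *\<^sub>R x)"
      using ab int_mult[of b "q *\<^sub>R x"] by simp
    then have "of_int b * g (q *\<^sub>R x) = of_int b * (q * g x)"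
      using ab(2) int_mult[of a x] by (simp add: ab(1))
    then show ?thesis using ab(2) by simp
  qed
  moreover have "closed ?S"
    by (intro closed_Collect_eq continuous_on_compose2[OF cont] continuous_intros) auto
  ultimately have "closure \<rat> \<subseteq> ?S" by (intro closure_minimal) auto
  then show "g (r *\<^sub>R x) = r *\<^sub>R g x" using Rats_closure_real by auto
qed (rule add)

lemma quotient_map_coset_of:
  assumes "add_subgroup N"
  shows "quotient_map euclidean (quotient_top N) (coset_of N)"
  using quotient_map_quotient_top[of N] assms unfolding add_subgroup_def coset_of_def by blast

lemma character_of_linear:
  fixes L :: "complex \<Rightarrow> real"
  assumes \<Lambda>: "complex_lattice \<Lambda>" and L: "linear L" "L ` \<Lambda> \<subseteq> \<int>"
  obtains \<psi> where "\<psi> \<in> characters \<Lambda>" "\<And>z. \<psi> (coset_of \<Lambda> z) = coset_of \<int> (L z)"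
proof -
  let ?\<psi> = "\<lambda>K\<in>carrier (elliptic_curve \<Lambda>). induced_map \<int> L K"
  note N = add_subgroup_lattice[OF \<Lambda>]
  have val: "?\<psi> (coset_of \<Lambda> z) = coset_of \<int> (L z)" for z
    using induced_map_coset[OF add_subgroup_Ints, of \<Lambda> L z] N L
    by (auto simp: carrier_elliptic_curve add_subgroup_def linear_add)
  have "?\<psi> \<in> Hom (elliptic_curve \<Lambda>) RZ"
    unfolding Hom_def hom_def carrier_elliptic_curve carrier_Mod[of UNIV \<int>]
    using val unfolding carrier_elliptic_curve
    by (auto simp: elliptic_curve_def coset_of_mult N add_subgroup_Ints linear_add[OF L(1)] simp del: mult_FactGroup)
  moreover have "continuous_map (quotient_top \<Lambda>) (quotient_top \<int>) ?\<psi>"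
  proof (rule continuous_compose_quotient_map[OF quotient_map_coset_of[OF N]])
    have "continuous_map euclidean euclidean L"
      using linear_continuous_on[OF L(1)[unfolded linear_conv_bounded_linear], of UNIV] by simp
    then have "continuous_map euclidean (quotient_top \<int>) (coset_of \<int> \<circ> L)"
      by (rule continuous_map_compose)
        (rule quotient_imp_continuous_map[OF quotient_map_coset_of[OF add_subgroup_Ints]])
    moreover have "?\<psi> \<circ> coset_of \<Lambda> = coset_of \<int> \<circ> L" using val by auto
    ultimately show "continuous_map euclidean (quotient_top \<int>) (?\<psi> \<circ> coset_of \<Lambda>)" by simp
  qed
  ultimately have "?\<psi> \<in> characters \<Lambda>" unfolding characters_def by blast
  then show thesis using that val by blast
qed

text \<open>
  Composed with the projection from \<open>\<complex>\<close> and with the embedding of \<open>\<real>/\<int>\<close> as the unit circle, a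
  character is a continuous nowhere vanishing function on the contractible space \<open>\<complex>\<close>. It therefore
  has a continuous logarithm, whose imaginary part over \<open>2 \<pi>\<close> is a lift to \<open>\<real>\<close>. The lift is additive up to
  integers; the integer error is continuous, hence constant, and subtracting the value at \<open>0\<close> removes
  it. Together with the converse above, this identifies \<open>Hom(E, \<real>/\<int>)\<close> with the real linear forms that
  are integral on \<open>\<Lambda>\<close>.
\<close>

lemma linear_of_character:
  assumes \<Lambda>: "complex_lattice \<Lambda>" and \<psi>: "\<psi> \<in> characters \<Lambda>"
  obtains L where "linear L" "L ` \<Lambda> \<subseteq> \<int>" "\<And>z. \<psi> (coset_of \<Lambda> z) = coset_of \<int> (L z)"
proof -
  note N = add_subgroup_lattice[OF \<Lambda>]
  have hom: "\<psi> \<in> hom (elliptic_curve \<Lambda>) RZ"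
    and cont: "continuous_map (quotient_top \<Lambda>) (quotient_top \<int>) \<psi>"
    using \<psi> unfolding characters_def Hom_def by auto
  have ex: "\<exists>t. \<psi> (coset_of \<Lambda> z) = coset_of \<int> t" for z
    using hom_carrier[OF hom] unfolding carrier_elliptic_curve carrier_Mod by blast
  \<comment> \<open>The embedding of \<open>\<real>/\<int>\<close> in the unit circle; periodicity makes the choice harmless.\<close>
  define w where "w X = cis (2 * pi * (SOME t. t \<in> X))" for X :: "real set"
  have w: "w (coset_of \<int> t) = cis (2 * pi * t)" for t
  proof -
    have "t \<in> coset_of \<int> t" by (auto simp: coset_of_def)
    then have "(SOME s. s \<in> coset_of \<int> t) \<in> coset_of \<int> t" by (rule someI)
    then obtain n where "(SOME s. s \<in> coset_of \<int> t) = of_int n + t"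
      by (auto simp: coset_of_def elim!: Ints_cases)
    then have "w (coset_of \<int> t) = cis (2 * pi * of_int n) * cis (2 * pi * t)"
      by (simp add: w_def cis_mult algebra_simps)
    then show ?thesis by simp
  qed
  have "continuous_map (quotient_top \<int>) euclidean w"
  proof (rule continuous_compose_quotient_map[OF quotient_map_coset_of[OF add_subgroup_Ints]])
    have "w \<circ> coset_of \<int> = (\<lambda>t. cis (2 * pi * t))" using w by auto
    then show "continuous_map euclidean euclidean (w \<circ> coset_of \<int>)"
      by (simp, intro continuous_intros)
  qed
  then have "continuous_map euclidean euclidean (w \<circ> \<psi> \<circ> coset_of \<Lambda>)"
    using cont quotient_imp_continuous_map[OF quotient_map_coset_of[OF N]]
    by (metis continuous_map_compose comp_assoc)
  then have h: "continuous_on UNIV (\<lambda>z. w (\<psi> (coset_of \<Lambda> z)))" by (simp add: o_def)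
  have h_cis: "\<exists>t. w (\<psi> (coset_of \<Lambda> z)) = cis (2 * pi * t) \<and> \<psi> (coset_of \<Lambda> z) = coset_of \<int> t" for z
    using ex[of z] w by metis
  obtain l where l: "continuous_on UNIV l" "\<And>z. w (\<psi> (coset_of \<Lambda> z)) = exp (l z)"
    using continuous_logarithm_on_contractible[OF h] h_cis
    by (metis UNIV_I cis_neq_zero convex_UNIV convex_imp_contractible)
  define M where "M z = Im (l z) / (2 * pi)" for z
  have M_cont: "continuous_on UNIV M"
    unfolding M_def by (intro continuous_intros l(1)) auto
  have M: "\<psi> (coset_of \<Lambda> z) = coset_of \<int> (M z)" for z
  proof -
    obtain t where t: "exp (l z) = cis (2 * pi * t)" "\<psi> (coset_of \<Lambda> z) = coset_of \<int> t"
      using h_cis[of z] l(2)[of z] by auto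
    then have "exp (l z) = exp (\<i> * of_real (2 * pi * t))" by (simp add: cis_conv_exp)
    then obtain n :: int where "l z = \<i> * of_real (2 * pi * t) + of_int (2 * n) * pi * \<i>"
      unfolding exp_eq by blast
    then have "M z = t + of_int n" unfolding M_def by (simp add: field_simps)
    then have "t - M z \<in> \<int>" by simp
    then show ?thesis unfolding t(2) by (simp only: coset_of_eq_iff[OF add_subgroup_Ints])
  qed
  have M_add: "M (x + y) - (M x + M y) \<in> \<int>" for x y
  proof -
    have "\<psi> (coset_of \<Lambda> x \<otimes>\<^bsub>elliptic_curve \<Lambda>\<^esub> coset_of \<Lambda> y)
        = \<psi> (coset_of \<Lambda> x) \<otimes>\<^bsub>RZ\<^esub> \<psi> (coset_of \<Lambda> y)"
      using hom_mult[OF hom] by (auto simp: carrier_elliptic_curve)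
    then have "coset_of \<int> (M (x + y)) = coset_of \<int> (M x + M y)"
      by (simp add: M coset_of_mult N add_subgroup_Ints elliptic_curve_def del: mult_FactGroup)
    then show ?thesis by (simp only: coset_of_eq_iff[OF add_subgroup_Ints])
  qed
  have const: "M (x + y) - (M x + M y) = M (0 + y) - (M 0 + M y)" for x y
  proof -
    let ?f = "\<lambda>x. M (x + y) - (M x + M y)"
    have "?f constant_on UNIV"
    proof (rule continuous_discrete_range_constant)
      show "continuous_on UNIV ?f"
        by (intro continuous_intros continuous_on_compose2[OF M_cont]) auto
      have "1 \<le> norm (?f x' - ?f x)" if "?f x' \<noteq> ?f x" for x x'
        using Ints_nonzero_abs_ge1[OF Ints_diff[OF M_add[of x' y] M_add[of x y]]] that by simp
      then show "\<exists>e>0. \<forall>x'. x' \<in> UNIV \<and> ?f x' \<noteq> ?f x \<longrightarrow> e \<le> norm (?f x' - ?f x)" for x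
        by (intro exI[of _ 1]) auto
    qed (rule convex_connected[OF convex_UNIV])
    then show ?thesis unfolding constant_on_def by (metis UNIV_I)
  qed
  have M0: "M 0 \<in> \<int>" using M_add[of 0 0] by simp
  define L where "L z = M z - M 0" for z
  have "L (x + y) = L x + L y" for x y using const[of x y] by (simp add: L_def)
  moreover have "continuous_on UNIV L" unfolding L_def by (intro continuous_intros M_cont)
  ultimately have "linear L" by (intro continuous_additive_imp_linear)
  moreover have L: "\<psi> (coset_of \<Lambda> z) = coset_of \<int> (L z)" for z
    using M M0 by (simp add: coset_of_eq_iff[OF add_subgroup_Ints] L_def)
  moreover have "L ` \<Lambda> \<subseteq> \<int>"
  proof clarify
    fix l assume "l \<in> \<Lambda>"
    then have "coset_of \<Lambda> l = coset_of \<Lambda> 0" using N by (simp add: coset_of_eq_iff)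
    then have "coset_of \<int> (L l) = coset_of \<int> (L 0)" using L by metis
    then show "L l \<in> \<int>"
      using linear_0[OF \<open>linear L\<close>] by (simp add: coset_of_eq_iff add_subgroup_Ints)
  qed
  ultimately show thesis by (intro that)
qed

section \<open>Bases of lattices\<close>

definition lattice_span :: "complex \<Rightarrow> complex \<Rightarrow> complex set" where
  "lattice_span w1 w2 = {of_int m * w1 + of_int n * w2 | m n. True}"

definition signed_area :: "complex \<Rightarrow> complex \<Rightarrow> real" where
  "signed_area w1 w2 = Im (cnj w1 * w2)"

text \<open>The coefficient of \<open>w2\<close> in the basis \<open>w1, w2\<close>, by Cramer's rule.\<close>

definition coord :: "complex \<Rightarrow> complex \<Rightarrow> complex \<Rightarrow> real" where
  "coord w1 w2 z = signed_area w1 z / signed_area w1 w2"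

lemma signed_area_swap: "signed_area w2 w1 = - signed_area w1 w2"
  by (simp add: signed_area_def)

lemma linear_coord: "linear (coord w1 w2)"
  by (rule linearI) (simp_all add: coord_def signed_area_def add_divide_distrib algebra_simps diff_divide_distrib)

lemma coord_combination:
  assumes "signed_area w1 w2 \<noteq> 0"
  shows "coord w1 w2 (of_real x * w1 + of_real y * w2) = y"
  using assms by (simp add: coord_def signed_area_def field_simps)

lemma coord_combination_swap:
  assumes "signed_area w1 w2 \<noteq> 0"
  shows "coord w2 w1 (of_real x * w1 + of_real y * w2) = x"
  using coord_combination[of w2 w1 y x] assms by (simp add: signed_area_swap[of w1 w2] add.commute)

lemma coord_expansion:
  assumes "signed_area w1 w2 \<noteq> 0"
  shows "of_real (coord w2 w1 z) * w1 + of_real (coord w1 w2 z) * w2 = z"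
proof -
  let ?D = "signed_area w1 w2"
  have D: "?D * coord w2 w1 z = signed_area z w2" "?D * coord w1 w2 z = signed_area w1 z"
    using assms unfolding coord_def signed_area_swap[of w2] by simp_all
  have "of_real ?D * (of_real (coord w2 w1 z) * w1 + of_real (coord w1 w2 z) * w2)
      = of_real (?D * coord w2 w1 z) * w1 + of_real (?D * coord w1 w2 z) * w2"
    by (simp add: algebra_simps)
  also have "\<dots> = of_real ?D * z"
    unfolding D by (simp add: complex_eq_iff signed_area_def algebra_simps)
  finally show ?thesis using assms by simp
qed

lemma linear_combination:
  fixes L :: "complex \<Rightarrow> 'a::real_vector"
  assumes "linear L"
  shows "L (of_real x * z + of_real y * w) = x *\<^sub>R L z + y *\<^sub>R L w"
  using assms by (simp add: linear_add linear_scale flip: scaleR_conv_of_real)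

lemma complex_lattice_basis:
  assumes "complex_lattice \<Lambda>"
  obtains w1 w2 where "signed_area w1 w2 \<noteq> 0" "\<Lambda> = lattice_span w1 w2"
proof -
  obtain w1 w2 where w: "w1 \<noteq> w2" "independent {w1, w2}" "\<Lambda> = lattice_span w1 w2"
    using assms unfolding complex_lattice_def lattice_span_def by blast
  have "w2 \<noteq> 0" using w(2) dependent_zero by blast
  have "w1 \<notin> span {w2}" using w(1,2) by (auto simp: independent_insert)
  moreover have "w1 = ((Re w1 * Re w2 + Im w1 * Im w2) / (cmod w2)\<^sup>2) *\<^sub>R w2" if "signed_area w1 w2 = 0"
  proof -
    have "(cmod w2)\<^sup>2 \<noteq> 0" using \<open>w2 \<noteq> 0\<close> by simp
    moreover have "Re w1 * Im w2 = Im w1 * Re w2" using that by (simp add: signed_area_def)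
    ultimately show ?thesis
      by (simp add: complex_eq_iff field_simps cmod_power2) (auto simp: algebra_simps power2_eq_square)
  qed
  ultimately have "signed_area w1 w2 \<noteq> 0" by (metis rangeI span_singleton)
  then show thesis using that w(3) by blast
qed

lemma linear_eq_scaled_coord:
  fixes L :: "complex \<Rightarrow> real"
  assumes "signed_area w1 w2 \<noteq> 0" "linear L" "L w1 = 0"
  shows "L z = L w2 * coord w1 w2 z"
  using linear_combination[OF assms(2), of "coord w2 w1 z" w1 "coord w1 w2 z" w2] assms(3)
  by (simp add: coord_expansion[OF assms(1)])

lemma coord_lattice_span:
  assumes "signed_area w1 w2 \<noteq> 0"
  shows "coord w1 w2 ` lattice_span w1 w2 \<subseteq> \<int>"
    and "z \<in> lattice_span w1 w2 \<longleftrightarrow> coord w2 w1 z \<in> \<int> \<and> coord w1 w2 z \<in> \<int>"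
proof -
  have int: "coord w2 w1 z \<in> \<int> \<and> coord w1 w2 z \<in> \<int>" if z: "z \<in> lattice_span w1 w2" for z
  proof -
    obtain m n where "z = of_real (of_int m) * w1 + of_real (of_int n) * w2"
      using z unfolding lattice_span_def by auto
    then show ?thesis
      using coord_combination[OF assms] coord_combination_swap[OF assms] by (metis Ints_of_int)
  qed
  then show "coord w1 w2 ` lattice_span w1 w2 \<subseteq> \<int>" by blast
  have "z \<in> lattice_span w1 w2" if "coord w2 w1 z \<in> \<int>" "coord w1 w2 z \<in> \<int>"
  proof -
    obtain m n where "coord w2 w1 z = of_int m" "coord w1 w2 z = of_int n"
      using \<open>coord w2 w1 z \<in> \<int>\<close> \<open>coord w1 w2 z \<in> \<int>\<close> by (elim Ints_cases)
    then have "z = of_int m * w1 + of_int n * w2"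
      using coord_expansion[OF assms, of z] by simp
    then show ?thesis unfolding lattice_span_def by blast
  qed
  with int show "z \<in> lattice_span w1 w2 \<longleftrightarrow> coord w2 w1 z \<in> \<int> \<and> coord w1 w2 z \<in> \<int>" by blast
qed

lemma lattice_span_rational_coord:
  assumes "signed_area w1 w2 \<noteq> 0" and "z \<in> rational_span (lattice_span w1 w2)"
  shows "coord w2 w1 z \<in> \<rat>"
proof -
  obtain q m n where z: "z = of_rat q * (of_int m * w1 + of_int n * w2)"
    using assms(2) unfolding rational_span_def lattice_span_def by blast
  have "z = of_real (of_rat q * of_int m) * w1 + of_real (of_rat q * of_int n) * w2"
    unfolding z by (simp add: algebra_simps of_real_of_rat)
  then have "coord w2 w1 z = of_rat q * of_int m"
    using coord_combination_swap[OF assms(1)] by metis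
  then show ?thesis by simp
qed

lemma lattice_span_subset:
  assumes "v1 = of_int a * w1 + of_int b * w2" "v2 = of_int c * w1 + of_int d * w2"
  shows "lattice_span v1 v2 \<subseteq> lattice_span w1 w2"
proof
  fix z assume "z \<in> lattice_span v1 v2"
  then obtain m n where "z = of_int m * v1 + of_int n * v2" unfolding lattice_span_def by blast
  then have "z = of_int (m * a + n * c) * w1 + of_int (m * b + n * d) * w2"
    by (simp add: assms algebra_simps)
  then show "z \<in> lattice_span w1 w2" unfolding lattice_span_def by blast
qed

text \<open>
  The primitive covector \<open>(m, n)\<close> is completed by Bezout to an integer matrix of determinant \<open>1\<close>: with
  \<open>a m + b n = 1\<close>, the vectors \<open>n w1 - m w2\<close> and \<open>a w1 + b w2\<close> form a basis of the same lattice. The first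
  one lies in the kernel of \<open>L\<close>, so its sign is free and can be used to prescribe the orientation.
\<close>

lemma unimodular_basis_change:
  fixes L :: "complex \<Rightarrow> real"
  assumes area: "signed_area w1 w2 \<noteq> 0" and L: "linear L"
    and m: "L w1 = of_int m" and n: "L w2 = of_int n" and cop: "coprime m n"
  obtains v1 v2 where "signed_area v1 v2 < 0" "lattice_span v1 v2 = lattice_span w1 w2"
    "L v1 = 0" "L v2 = 1"
proof -
  obtain a b where ab: "a * m + b * n = 1"
    using bezout_int[of m n] cop by auto
  \<comment> \<open>The sign of the kernel vector that yields a negatively oriented basis.\<close>
  define s :: int where "s = (if signed_area w1 w2 < 0 then 1 else - 1)"
  have s: "s * s = 1" by (simp add: s_def)
  define v1 where "v1 = of_int (s * n) * w1 + of_int (- s * m) * w2"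
  define v2 where "v2 = of_int a * w1 + of_int b * w2"
  have "signed_area v1 v2 = of_int (s * (a * m + b * n)) * signed_area w1 w2"
    by (simp add: v1_def v2_def signed_area_def algebra_simps)
  then have "signed_area v1 v2 < 0"
    using area by (simp add: ab s_def)
  moreover have "w1 = of_int (s * b) * v1 + of_int m * v2"
  proof -
    have "of_int (s * b) * v1 + of_int m * v2
        = of_int (s * s * b * n + a * m) * w1 + of_int (m * b - s * s * m * b) * w2"
      by (simp add: v1_def v2_def algebra_simps)
    then show ?thesis using ab by (simp add: s add.commute)
  qed
  moreover have "w2 = of_int (- s * a) * v1 + of_int n * v2"
  proof -
    have "of_int (- s * a) * v1 + of_int n * v2
        = of_int (n * a - s * s * n * a) * w1 + of_int (s * s * a * m + b * n) * w2"
      by (simp add: v1_def v2_def algebra_simps)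
    then show ?thesis using ab by (simp add: s)
  qed
  moreover have "L v1 = 0"
    using linear_combination[OF L, of "of_int (s * n)" w1 "of_int (- s * m)" w2]
    by (simp add: v1_def m n)
  moreover have "L v2 = of_int (a * m + b * n)"
    using linear_combination[OF L, of "of_int a" w1 "of_int b" w2]
    by (simp add: v2_def m n)
  ultimately show thesis
    using that[of v1 v2] lattice_span_subset[OF v1_def v2_def] lattice_span_subset[of w1 _ v1 _ v2 w2] ab
    by (metis of_int_1 subset_antisym)
qed

section \<open>The characters orthogonal to \<open>\<xi>\<close>\<close>

text \<open>
  The hypothesis says that the character given by \<open>L\<close> pairs with \<open>\<eta>\<close> to \<open>1\<close>. A common divisor \<open>d\<close> of \<open>m\<close>
  and \<open>n\<close> would make \<open>L\<close> divisible by \<open>d\<close> on \<open>\<Lambda>\<close>, and then \<open>1\<close> divisible by \<open>d\<close> in the profinite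
  integers. Concretely, \<open>\<eta>(1/d)\<close> is represented by some \<open>z\<close> with \<open>d z \<in> \<Lambda>\<close>, so that \<open>L z\<close> is an integer,
  whereas it should be congruent to \<open>1/d\<close>.
\<close>

lemma coprime_of_pairing_one:
  fixes L :: "complex \<Rightarrow> real"
  assumes \<Lambda>: "complex_lattice \<Lambda>" "\<Lambda> = lattice_span w1 w2" and \<eta>: "\<eta> \<in> Tate (E_tor \<Lambda>)"
    and L: "linear L" "L w1 = of_int m" "L w2 = of_int n"
    and one: "\<And>q z. q \<in> \<rat> \<Longrightarrow> \<eta> (coset_of \<int> q) = coset_of \<Lambda> z \<Longrightarrow> L z - q \<in> \<int>"
  shows "coprime m n"
proof (rule ccontr)
  assume ncop: "\<not> coprime m n"
  \<comment> \<open>When \<open>m = n = 0\<close> the gcd is \<open>0\<close>, and any common divisor greater than \<open>1\<close> serves.\<close>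
  define d where "d = (if gcd m n = 0 then 2 else gcd m n)"
  have "gcd m n \<noteq> 1" using ncop by (simp add: coprime_iff_gcd_eq_1)
  then have "gcd m n = 0 \<or> gcd m n > 1" using gcd_ge_0_int[of m n] by linarith
  then have d: "d > 1" "d dvd m" "d dvd n" unfolding d_def by auto
  note N = add_subgroup_lattice[OF \<Lambda>(1)]
  define q :: real where "q = 1 / of_int d"
  have q: "q \<in> \<rat>" unfolding q_def by simp
  obtain z where z: "\<eta> (coset_of \<int> q) = coset_of \<Lambda> z"
    using Tate_coset[OF \<eta>[unfolded E_tor_def] q] by blast
  have mult: "\<eta> (coset_of \<int> (of_int k * q)) = coset_of \<Lambda> (of_int k * z)" for k
    using Tate_int_multiple[OF N \<eta>[unfolded E_tor_def] q z] .
  have "coset_of \<int> (of_int d * q) = coset_of \<int> (of_int 0 * q)"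
    using d by (simp add: q_def coset_of_eq_iff[OF add_subgroup_Ints])
  then have "coset_of \<Lambda> (of_int d * z) = coset_of \<Lambda> (of_int 0 * z)"
    using mult by metis
  then have "of_int d * z \<in> \<Lambda>" by (simp add: coset_of_eq_iff[OF N])
  then obtain i j where ij: "of_int d * z = of_int i * w1 + of_int j * w2"
    unfolding \<Lambda>(2) lattice_span_def by blast
  have "of_int d * L z = L (of_real (of_int d) * z + of_real 0 * z)"
    using linear_combination[OF L(1), of "of_int d" z 0 z] by simp
  also have "\<dots> = L (of_real (of_int i) * w1 + of_real (of_int j) * w2)" by (simp add: ij)
  also have "\<dots> = of_int (i * m + j * n)"
    by (subst linear_combination[OF L(1)]) (simp add: L)
  finally have dL: "of_int d * L z = of_int (i * m + j * n)" .
  obtain c where "i * m + j * n = d * c" using d(2,3) by (metis dvd_add dvd_mult dvdE)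
  then have "L z = of_int c" using dL d(1) by simp
  then have "q \<in> \<int>" using one[OF q z] by (metis Ints_diff Ints_of_int diff_diff_eq2 add_diff_cancel_left')
  then obtain k where "q = of_int k" by (elim Ints_cases)
  then have "of_int (d * k) = (1 :: real)" using d(1) by (simp add: q_def field_simps)
  then have "d * k = 1" by linarith
  then show False using d(1) pos_zmult_eq_1_iff[of d k] by simp
qed

text \<open>
  A character that pairs with \<open>\<eta>\<close> to \<open>1\<close> is primitive, hence a coordinate function of some lattice
  basis. The negative orientation is the one of the basis \<open>e1, e2\<close>.
\<close>

lemma adapted_basis:
  assumes \<Lambda>: "complex_lattice \<Lambda>" and \<eta>: "\<eta> \<in> Tate (E_tor \<Lambda>)"
    and \<psi>: "\<psi> \<in> characters \<Lambda>" "Tate_map \<psi> \<eta> = Zhat_one"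
  obtains w1 w2 where "signed_area w1 w2 < 0" "\<Lambda> = lattice_span w1 w2"
    "\<And>z. \<psi> (coset_of \<Lambda> z) = coset_of \<int> (coord w1 w2 z)"
proof -
  obtain L where L: "linear L" "L ` \<Lambda> \<subseteq> \<int>" "\<And>z. \<psi> (coset_of \<Lambda> z) = coset_of \<int> (L z)"
    using linear_of_character[OF \<Lambda> \<psi>(1)] by blast
  obtain w1 w2 where w: "signed_area w1 w2 \<noteq> 0" "\<Lambda> = lattice_span w1 w2"
    using complex_lattice_basis[OF \<Lambda>] by blast
  have "of_int 1 * w1 + of_int 0 * w2 \<in> \<Lambda>" "of_int 0 * w1 + of_int 1 * w2 \<in> \<Lambda>"
    unfolding w(2) lattice_span_def by blast+
  then have "w1 \<in> \<Lambda>" "w2 \<in> \<Lambda>" by simp_all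
  then obtain m n where mn: "L w1 = of_int m" "L w2 = of_int n"
    using L(2) by (meson Ints_cases image_subset_iff)
  have "L z - q \<in> \<int>" if "q \<in> \<rat>" "\<eta> (coset_of \<int> q) = coset_of \<Lambda> z" for q z
  proof -
    have "coset_of \<int> (L z) = coset_of \<int> q"
      using \<psi>(2) that L(3)[of z] unfolding Tate_map_eq_Zhat_one_iff by force
    then show ?thesis by (simp only: coset_of_eq_iff[OF add_subgroup_Ints])
  qed
  then have "coprime m n"
    by (intro coprime_of_pairing_one[OF \<Lambda> w(2) \<eta> L(1) mn])
  then obtain v1 v2 where v: "signed_area v1 v2 < 0" "lattice_span v1 v2 = \<Lambda>" "L v1 = 0" "L v2 = 1"
    using unimodular_basis_change[OF w(1) L(1) mn] w(2) by metis
  have "L z = coord v1 v2 z" for z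
    using linear_eq_scaled_coord[of v1 v2 L z] v L(1) by simp
  then show thesis using that[of v1 v2] v L(3) by simp
qed

text \<open>
  The points \<open>\<xi>(q)\<close> lie on the circle \<open>\<real> w1\<close> in \<open>E\<close>, where \<open>L\<close> is multiplication by \<open>m\<close>. As \<open>L\<close> kills them,
  \<open>m \<xi> = 0\<close>; since \<open>\<rat>/\<int>\<close> is divisible, \<open>m \<noteq> 0\<close> would force \<open>\<xi> = 0\<close>.
\<close>

lemma character_vanishing_on_line:
  fixes L :: "complex \<Rightarrow> real"
  assumes \<Lambda>: "complex_lattice \<Lambda>" "\<Lambda> = lattice_span w1 w2" and area: "signed_area w1 w2 \<noteq> 0"
    and \<xi>: "\<xi> \<in> Tate (E_tor \<Lambda>)" "\<xi> \<noteq> zero_hom QZ (E_tor \<Lambda>)"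
    and line: "\<And>q z. q \<in> \<rat> \<Longrightarrow> \<xi> (coset_of \<int> q) = coset_of \<Lambda> z \<Longrightarrow> coord w1 w2 z \<in> \<int>"
    and L: "linear L" "L w1 = of_int m" "L w2 = of_int n"
    and zero: "\<And>q z. q \<in> \<rat> \<Longrightarrow> \<xi> (coset_of \<int> q) = coset_of \<Lambda> z \<Longrightarrow> L z \<in> \<int>"
  shows "m = 0"
proof (rule ccontr)
  assume m: "m \<noteq> 0"
  note N = add_subgroup_lattice[OF \<Lambda>(1)]
  have "\<xi> (coset_of \<int> q) = \<Lambda>" if q: "q \<in> \<rat>" for q
  proof -
    define r where "r = q / of_int m"
    have r: "r \<in> \<rat>" using q by (simp add: r_def)
    obtain z where z: "\<xi> (coset_of \<int> r) = coset_of \<Lambda> z"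
      using Tate_coset[OF \<xi>(1)[unfolded E_tor_def] r] by blast
    have y: "coord w1 w2 z \<in> \<int>" using line[OF r z] .
    have "L z = of_int m * coord w2 w1 z + of_int n * coord w1 w2 z"
      using linear_combination[OF L(1), of "coord w2 w1 z" w1 "coord w1 w2 z" w2] L(2,3)
      by (simp add: coord_expansion[OF area])
    then have "of_int m * coord w2 w1 z = L z - of_int n * coord w1 w2 z" by simp
    also have "\<dots> \<in> \<int>" using zero[OF r z] y by simp
    finally have "coord w2 w1 (of_real (of_int m) * z + of_real 0 * z) \<in> \<int>"
      by (subst linear_combination[OF linear_coord]) simp
    moreover have "coord w1 w2 (of_real (of_int m) * z + of_real 0 * z) \<in> \<int>"
      by (subst linear_combination[OF linear_coord]) (use y in simp)
    ultimately have "of_int m * z \<in> \<Lambda>"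
      unfolding \<Lambda>(2) coord_lattice_span(2)[OF area] by simp
    moreover have "\<xi> (coset_of \<int> q) = coset_of \<Lambda> (of_int m * z)"
      using Tate_int_multiple[OF N \<xi>(1)[unfolded E_tor_def] r z, of m] m by (simp add: r_def)
    ultimately show ?thesis using coset_of_eq_self_iff[OF N] by metis
  qed
  then have "\<xi> = zero_hom QZ (E_tor \<Lambda>)"
    using Tate_ext[OF \<xi>(1)]
    by (intro extensionalityI[of _ "carrier QZ"]) (auto simp: zero_hom_def carrier_QZ E_tor_def)
  with \<xi>(2) show False by blast
qed

text \<open>
  If \<open>\<psi>\<close> kills \<open>\<xi>\<close> and pairs with \<open>\<eta>\<close> to \<open>1\<close>, then \<open>\<psi>\<close> is a basis coordinate. As \<open>\<xi> \<noteq> 0\<close>, every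
  other character that kills \<open>\<xi>\<close> vanishes on the kernel of this coordinate and so is an integer
  multiple of \<open>\<psi>\<close>: the orthogonal of \<open>\<xi>\<close> is \<open>\<int>\<psi>\<close>, and its pairing with \<open>\<eta>\<close> is \<open>\<int>\<close>. Without \<open>\<xi> \<noteq> 0\<close> the
  orthogonal would contain all characters and could pair with \<open>\<eta>\<close> to more than \<open>\<int>\<close>.
\<close>

lemma perp_pairing_eq_Ints_iff:
  assumes \<Lambda>: "complex_lattice \<Lambda>" and \<xi>: "\<xi> \<in> Tate (E_tor \<Lambda>)" "\<xi> \<noteq> zero_hom QZ (E_tor \<Lambda>)"
    and \<eta>: "\<eta> \<in> Tate (E_tor \<Lambda>)"
  shows "perp_pairing \<Lambda> \<xi> \<eta> = range Zhat_of_int \<longleftrightarrow>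
    (\<exists>\<psi>\<in>perp \<Lambda> \<xi>. Tate_map \<psi> \<eta> = Zhat_one)"
proof
  assume "perp_pairing \<Lambda> \<xi> \<eta> = range Zhat_of_int"
  then have "Zhat_one \<in> perp_pairing \<Lambda> \<xi> \<eta>" by (metis Zhat_of_int_1 rangeI)
  then show "\<exists>\<psi>\<in>perp \<Lambda> \<xi>. Tate_map \<psi> \<eta> = Zhat_one" unfolding perp_pairing_def by force
next
  assume "\<exists>\<psi>\<in>perp \<Lambda> \<xi>. Tate_map \<psi> \<eta> = Zhat_one"
  then obtain \<psi> where \<psi>: "\<psi> \<in> characters \<Lambda>" "Tate_map \<psi> \<xi> = Zhat_zero" "Tate_map \<psi> \<eta> = Zhat_one"
    unfolding perp_def by blast
  obtain w1 w2 where area: "signed_area w1 w2 < 0" and w: "\<Lambda> = lattice_span w1 w2"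
    and \<psi>_coord: "\<And>z. \<psi> (coset_of \<Lambda> z) = coset_of \<int> (coord w1 w2 z)"
    using adapted_basis[OF \<Lambda> \<eta> \<psi>(1,3)] by blast
  then have area': "signed_area w1 w2 \<noteq> 0" by simp
  note Z = coset_of_eq_iff[OF add_subgroup_Ints]
  have \<xi>_coord: "coord w1 w2 z \<in> \<int>"
    if "q \<in> \<rat>" "\<xi> (coset_of \<int> q) = coset_of \<Lambda> z" for q z
    using \<psi>(2) that \<psi>_coord[of z] unfolding Tate_map_eq_Zhat_zero_iff
    by (metis Z diff_zero)
  have \<eta>_coord: "coord w1 w2 z - q \<in> \<int>"
    if "q \<in> \<rat>" "\<eta> (coset_of \<int> q) = coset_of \<Lambda> z" for q z
    using \<psi>(3) that \<psi>_coord[of z] unfolding Tate_map_eq_Zhat_one_iff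
    by (metis Z)
  have \<xi>_val: "\<exists>z. \<xi> (coset_of \<int> q) = coset_of \<Lambda> z" if "q \<in> \<rat>" for q
    using Tate_coset[OF \<xi>(1)[unfolded E_tor_def] that] by blast
  have \<eta>_val: "\<exists>z. \<eta> (coset_of \<int> q) = coset_of \<Lambda> z" if "q \<in> \<rat>" for q
    using Tate_coset[OF \<eta>[unfolded E_tor_def] that] by blast
  have in_\<Lambda>: "w1 \<in> \<Lambda>" "w2 \<in> \<Lambda>"
    using coord_combination[OF area', of 1 0] coord_combination[OF area', of 0 1]
      coord_combination_swap[OF area', of 1 0] coord_combination_swap[OF area', of 0 1]
    unfolding w coord_lattice_span(2)[OF area'] by auto
  have pairing: "Tate_map \<psi>' \<eta> = Zhat_of_int k"
    if "\<And>z. \<psi>' (coset_of \<Lambda> z) = coset_of \<int> (of_int k * coord w1 w2 z)" for \<psi>' k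
    unfolding Tate_map_eq_Zhat_of_int_iff
  proof
    fix q :: real assume q: "q \<in> \<rat>"
    obtain z where z: "\<eta> (coset_of \<int> q) = coset_of \<Lambda> z" using \<eta>_val[OF q] by blast
    have "of_int k * coord w1 w2 z - of_int k * q = of_int k * (coord w1 w2 z - q)"
      by (simp add: algebra_simps)
    also have "\<dots> \<in> \<int>" using \<eta>_coord[OF q z] by simp
    finally show "\<psi>' (\<eta> (coset_of \<int> q)) = coset_of \<int> (of_int k * q)"
      unfolding z that Z .
  qed
  show "perp_pairing \<Lambda> \<xi> \<eta> = range Zhat_of_int"
  proof
    show "perp_pairing \<Lambda> \<xi> \<eta> \<subseteq> range Zhat_of_int"
    proof
      fix f assume "f \<in> perp_pairing \<Lambda> \<xi> \<eta>"
      then obtain \<psi>' where \<psi>': "\<psi>' \<in> characters \<Lambda>" "Tate_map \<psi>' \<xi> = Zhat_zero" "f = Tate_map \<psi>' \<eta>"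
        unfolding perp_pairing_def perp_def by blast
      obtain L where L: "linear L" "L ` \<Lambda> \<subseteq> \<int>" "\<And>z. \<psi>' (coset_of \<Lambda> z) = coset_of \<int> (L z)"
        using linear_of_character[OF \<Lambda> \<psi>'(1)] by blast
      obtain m n where mn: "L w1 = of_int m" "L w2 = of_int n"
        using L(2) in_\<Lambda> by (meson Ints_cases image_subset_iff)
      have "L z \<in> \<int>" if "q \<in> \<rat>" "\<xi> (coset_of \<int> q) = coset_of \<Lambda> z" for q z
        using \<psi>'(2) that L(3)[of z] unfolding Tate_map_eq_Zhat_zero_iff by (metis Z diff_zero)
      then have "m = 0"
        using \<xi>_coord by (intro character_vanishing_on_line[OF \<Lambda> w area' \<xi> _ L(1) mn])
      then have "L z = of_int n * coord w1 w2 z" for z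
        using linear_eq_scaled_coord[OF area' L(1), of z] mn by simp
      then have "f = Zhat_of_int n" using pairing[of \<psi>' n] L(3) \<psi>'(3) by simp
      then show "f \<in> range Zhat_of_int" by blast
    qed
    show "range Zhat_of_int \<subseteq> perp_pairing \<Lambda> \<xi> \<eta>"
    proof
      fix f assume "f \<in> range Zhat_of_int"
      then obtain k where f: "f = Zhat_of_int k" by blast
      let ?L = "\<lambda>z. of_int k * coord w1 w2 z"
      have lin: "linear ?L" using linear_coord[of w1 w2] by (simp add: linear_iff algebra_simps)
      have L\<Lambda>: "?L ` \<Lambda> \<subseteq> \<int>"
        using coord_lattice_span(1)[OF area'] unfolding w by auto
      obtain \<psi>' where \<psi>': "\<psi>' \<in> characters \<Lambda>" "\<And>z. \<psi>' (coset_of \<Lambda> z) = coset_of \<int> (?L z)"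
        using character_of_linear[OF \<Lambda> lin L\<Lambda>] by blast
      have "\<psi>' (\<xi> (coset_of \<int> q)) = coset_of \<int> 0" if q: "q \<in> \<rat>" for q
      proof -
        obtain z where z: "\<xi> (coset_of \<int> q) = coset_of \<Lambda> z" using \<xi>_val[OF q] by blast
        show ?thesis unfolding z \<psi>'(2) Z using \<xi>_coord[OF q z] by simp
      qed
      then have "\<psi>' \<in> perp \<Lambda> \<xi>" using \<psi>'(1) by (simp add: perp_def Tate_map_eq_Zhat_zero_iff)
      then show "f \<in> perp_pairing \<Lambda> \<xi> \<eta>"
        using pairing[OF \<psi>'(2)] unfolding f perp_pairing_def by force
    qed
  qed
qed

section \<open>Parabolic lattices up to scale\<close>

definition combination_coset :: "complex \<Rightarrow> complex \<Rightarrow> real set \<Rightarrow> real set \<Rightarrow> complex set" where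
  "combination_coset w1 w2 X Y = {of_real x * w1 + of_real y * w2 | x y. x \<in> X \<and> y \<in> Y}"

text \<open>
  What a parabolic lattice looks like in the basis \<open>w1, w2\<close> that is the image of \<open>e1, e2\<close>: the
  morphism is \<open>(x, y) \<mapsto> (u x + v y) w1 + y w2\<close>.
\<close>

definition parabolic_shape ::
  "complex \<Rightarrow> complex \<Rightarrow> (real set \<Rightarrow> real set) \<Rightarrow> (real set \<Rightarrow> real set) \<Rightarrow> q_lattice" where
  "parabolic_shape w1 w2 u v =
     (lattice_span w1 w2,
      \<lambda>p\<in>carrier QZ2. combination_coset w1 w2 (u (fst p) \<otimes>\<^bsub>QZ\<^esub> v (snd p)) (snd p))"

lemma combination_coset_eq:
  "combination_coset w1 w2 (coset_of \<int> x) (coset_of \<int> y)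
     = coset_of (lattice_span w1 w2) (of_real x * w1 + of_real y * w2)"
proof -
  have eq: "of_real (of_int m + x) * w1 + of_real (of_int n + y) * w2
      = (of_int m * w1 + of_int n * w2) + (of_real x * w1 + of_real y * w2)" for m n
    by (simp add: algebra_simps)
  show ?thesis
  proof (intro equalityI subsetI)
    fix z assume "z \<in> combination_coset w1 w2 (coset_of \<int> x) (coset_of \<int> y)"
    then obtain m n where "z = of_real (of_int m + x) * w1 + of_real (of_int n + y) * w2"
      unfolding combination_coset_def coset_of_def by (auto elim!: Ints_cases)
    then show "z \<in> coset_of (lattice_span w1 w2) (of_real x * w1 + of_real y * w2)"
      unfolding eq coset_of_def lattice_span_def by blast
  next
    fix z assume "z \<in> coset_of (lattice_span w1 w2) (of_real x * w1 + of_real y * w2)"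
    then obtain m n where "z = of_real (of_int m + x) * w1 + of_real (of_int n + y) * w2"
      unfolding eq coset_of_def lattice_span_def by blast
    moreover have "of_int m + x \<in> coset_of \<int> x" "of_int n + y \<in> coset_of \<int> y"
      unfolding coset_of_def by auto
    ultimately show "z \<in> combination_coset w1 w2 (coset_of \<int> x) (coset_of \<int> y)"
      unfolding combination_coset_def by blast
  qed
qed

lemma transport_transport: "transport f (transport g L) = transport (\<lambda>z. f (g z)) L"
  unfolding transport_def by (auto simp: image_image intro!: restrict_ext)

lemma transport_id: "snd L \<in> extensional (carrier QZ2) \<Longrightarrow> transport (\<lambda>z. z) L = L"
  by (cases L) (auto simp: transport_def extensional_restrict)

text \<open>
  Scaling by \<open>1\<close> is the identity only on extensional morphisms, because transport restricts them.
\<close>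

lemma up_to_scale_eq_iff:
  assumes "snd L \<in> extensional (carrier QZ2)"
  shows "up_to_scale L = up_to_scale L' \<longleftrightarrow> L \<in> up_to_scale L'"
proof
  have "(*) (1::complex) = (\<lambda>z. z)" by auto
  then have "L = transport ((*) 1) L" using transport_id[OF assms] by simp
  then have "L \<in> up_to_scale L" unfolding up_to_scale_def by (force intro: exI[of _ 1])
  then show "L \<in> up_to_scale L'" if "up_to_scale L = up_to_scale L'" using that by simp
next
  assume "L \<in> up_to_scale L'"
  then obtain c where c: "c \<noteq> 0" "L = transport ((*) c) L'" unfolding up_to_scale_def by blast
  have mult: "transport ((*) d) L = transport ((*) (d * c)) L'" for d
    unfolding c(2) transport_transport by (simp add: mult.assoc[symmetric])
  show "up_to_scale L = up_to_scale L'"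
  proof (intro equalityI subsetI)
    fix K assume "K \<in> up_to_scale L"
    then obtain d where "d \<noteq> 0" "K = transport ((*) (d * c)) L'"
      unfolding up_to_scale_def mult by blast
    then show "K \<in> up_to_scale L'"
      unfolding up_to_scale_def using c(1) by (auto intro!: exI[of _ "d * c"])
  next
    fix K assume "K \<in> up_to_scale L'"
    then obtain d where d: "d \<noteq> 0" "K = transport ((*) d) L'" unfolding up_to_scale_def by blast
    then have "K = transport ((*) (d / c)) L" unfolding mult using c(1) by simp
    then show "K \<in> up_to_scale L"
      unfolding up_to_scale_def using c(1) d(1) by (auto intro!: exI[of _ "d / c"])
  qed
qed

lemma transport_standard:
  fixes f :: "complex \<Rightarrow> complex"
  assumes f: "linear f"
  shows "transport f (\<Lambda>\<^sub>0, Zhat_mat_hom u v Zhat_zero Zhat_one) = parabolic_shape (f e1) (f e2) u v"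
proof -
  have comb: "f (of_real x * e1 + of_real y * e2) = of_real x * f e1 + of_real y * f e2" for x y
    using linear_combination[OF f] by (simp add: scaleR_conv_of_real)
  have comb_int: "f (of_int m * e1 + of_int n * e2) = of_int m * f e1 + of_int n * f e2" for m n
    using comb[of "of_int m" "of_int n"] by simp
  have "f ` \<Lambda>\<^sub>0 = {f (of_int m * e1 + of_int n * e2) | m n. True}"
    unfolding \<Lambda>\<^sub>0_def by blast
  then have lattice: "f ` \<Lambda>\<^sub>0 = lattice_span (f e1) (f e2)"
    by (simp add: comb_int lattice_span_def)
  have cosets: "f ` basis_coset X Y = combination_coset (f e1) (f e2) X Y" for X Y
  proof -
    have "f ` basis_coset X Y = {f (of_real x * e1 + of_real y * e2) | x y. x \<in> X \<and> y \<in> Y}"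
      unfolding basis_coset_def by blast
    then show ?thesis by (simp add: comb combination_coset_def)
  qed
  have second_row: "Zhat_zero X \<otimes>\<^bsub>QZ\<^esub> Zhat_one Y = Y" if "X \<in> carrier QZ" "Y \<in> carrier QZ" for X Y
  proof -
    interpret QZ: comm_group QZ by (rule comm_group_QZ)
    show ?thesis using that QZ.l_one
      by (simp add: Zhat_zero_def zero_hom_def Zhat_one_def del: mult_FactGroup one_FactGroup)
  qed
  show ?thesis
    unfolding transport_def parabolic_shape_def Zhat_mat_hom_def fst_conv snd_conv lattice
    by (rule arg_cong[where f = "Pair _"], rule restrict_ext)
      (auto simp: cosets second_row simp del: mult_FactGroup)
qed

text \<open>
  The inverse of \<open>\<alpha>\<close> sends \<open>e1\<close> to \<open>1/a\<close> and \<open>e2\<close> to \<open>-b/a - \<i>\<close>, and scaling by \<open>c\<close> gives a pair with ratio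
  \<open>w2/w1 = -b - a \<i>\<close>. Since \<open>a\<close>, \<open>b\<close>, \<open>c\<close> are only subject to \<open>a > 0\<close> and \<open>c \<noteq> 0\<close>, exactly the negatively
  oriented pairs arise; the pair determines \<open>a\<close> and \<open>b\<close> by its ratio and \<open>c\<close> as \<open>a w1\<close>.
\<close>

lemma scaled_parabolic_iff:
  "(\<exists>L\<in>parabolic_q_lattices. K \<in> up_to_scale L) \<longleftrightarrow>
    (\<exists>w1 w2 u v. signed_area w1 w2 < 0 \<and> u \<in> Zhat \<and> v \<in> Zhat \<and> K = parabolic_shape w1 w2 u v)"
proof -
  have lin: "linear (\<lambda>z. c * inv_into UNIV (real_mat_act a b 0 1) z)" if "a > 0" for a b c
    using that inv_real_mat_act[of a b]
    by (intro linearI) (auto simp: real_mat_act_def Let_def complex_eq_iff e1_def e2_def field_simps)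
  have tr: "transport ((*) c) (transport (inv_into UNIV (real_mat_act a b 0 1))
        (\<Lambda>\<^sub>0, Zhat_mat_hom u v Zhat_zero Zhat_one))
      = parabolic_shape (c / of_real a) (- c * (of_real (b / a) + \<i>)) u v"
    if "a > 0" for a b c u v
  proof -
    have "c * inv_into UNIV (real_mat_act a b 0 1) e1 = c / of_real a"
      "c * inv_into UNIV (real_mat_act a b 0 1) e2 = - c * (of_real (b / a) + \<i>)"
      using that inv_real_mat_act[of a b]
      by (auto simp: real_mat_act_def Let_def e1_def e2_def field_simps)
    then show ?thesis
      unfolding transport_transport transport_standard[OF lin[OF that]] by simp
  qed
  show ?thesis
  proof
    assume "\<exists>L\<in>parabolic_q_lattices. K \<in> up_to_scale L"
    then obtain u v a b c where *: "u \<in> Zhat" "v \<in> Zhat" "a > 0" "c \<noteq> 0"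
      "K = parabolic_shape (c / of_real a) (- c * (of_real (b / a) + \<i>)) u v"
      unfolding parabolic_q_lattices_def up_to_scale_def using tr by blast
    have "signed_area (c / of_real a) (- c * (of_real (b / a) + \<i>)) = - (((Re c)\<^sup>2 + (Im c)\<^sup>2) / a)"
      using *(3) by (simp add: signed_area_def power2_eq_square field_simps)
    also have "\<dots> = - ((cmod c)\<^sup>2 / a)" by (simp add: cmod_power2)
    also have "\<dots> < 0" using * by simp
    finally show "\<exists>w1 w2 u v. signed_area w1 w2 < 0 \<and> u \<in> Zhat \<and> v \<in> Zhat \<and>
        K = parabolic_shape w1 w2 u v"
      using * by blast
  next
    assume "\<exists>w1 w2 u v. signed_area w1 w2 < 0 \<and> u \<in> Zhat \<and> v \<in> Zhat \<and>
        K = parabolic_shape w1 w2 u v"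
    then obtain w1 w2 u v where w: "signed_area w1 w2 < 0" "u \<in> Zhat" "v \<in> Zhat"
      "K = parabolic_shape w1 w2 u v" by blast
    have w1: "w1 \<noteq> 0" using w(1) by (auto simp: signed_area_def)
    define a where "a = - Im (w2 / w1)"
    define b where "b = - Re (w2 / w1)"
    define c where "c = of_real a * w1"
    have "Im (w2 / w1) = signed_area w1 w2 / (cmod w1)\<^sup>2"
      by (simp add: signed_area_def complex_div_cnj[of w2] mult.commute)
    then have a: "a > 0" using w(1) w1 by (simp add: a_def divide_neg_pos)
    have "w2 / w1 = - of_real b - of_real a * \<i>" by (simp add: a_def b_def complex_eq_iff)
    then have "w2 = w1 * (- of_real b - of_real a * \<i>)" using w1 by (simp add: field_simps)
    moreover have "- c * (of_real (b / a) + \<i>) = w1 * (- of_real b - of_real a * \<i>)"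
      using a by (simp add: c_def field_simps)
    ultimately have "- c * (of_real (b / a) + \<i>) = w2" by simp
    moreover have "c / of_real a = w1" using a by (simp add: c_def)
    ultimately have "K = transport ((*) c) (transport (inv_into UNIV (real_mat_act a b 0 1))
        (\<Lambda>\<^sub>0, Zhat_mat_hom u v Zhat_zero Zhat_one))"
      using tr[OF a, of c b] w(4) by simp
    moreover have "c \<noteq> 0" using a w1 by (simp add: c_def)
    ultimately show "\<exists>L\<in>parabolic_q_lattices. K \<in> up_to_scale L"
      unfolding parabolic_q_lattices_def up_to_scale_def using a w(2,3) by blast
  qed
qed

text \<open>
  In a basis \<open>w1, w2\<close>, being parabolic means that the second coordinate is \<open>0\<close> on \<open>\<xi>\<close> and \<open>1\<close> on \<open>\<eta>\<close>, the
  first coordinates \<open>u\<close> and \<open>v\<close> being arbitrary. The second coordinate is a character, and conversely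
  a character with these two values is the second coordinate of an adapted basis.
\<close>

lemma parabolic_up_to_scale_iff_pairing_one:
  assumes \<Lambda>: "complex_lattice \<Lambda>" and \<xi>: "\<xi> \<in> Tate (E_tor \<Lambda>)" and \<eta>: "\<eta> \<in> Tate (E_tor \<Lambda>)"
  shows "up_to_scale (q_lattice_of \<Lambda> \<xi> \<eta>) \<in> \<theta> ` parabolic_q_lattices \<longleftrightarrow>
    (\<exists>\<psi>\<in>perp \<Lambda> \<xi>. Tate_map \<psi> \<eta> = Zhat_one)" (is "?par \<longleftrightarrow> ?one")
proof -
  note N = add_subgroup_lattice[OF \<Lambda>]
  note Z = coset_of_eq_iff[OF add_subgroup_Ints]
  note \<xi>' = \<xi>[unfolded E_tor_def] and \<eta>' = \<eta>[unfolded E_tor_def]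
  let ?K = "q_lattice_of \<Lambda> \<xi> \<eta>"
  have "?par \<longleftrightarrow> (\<exists>L\<in>parabolic_q_lattices. ?K \<in> up_to_scale L)"
    unfolding \<theta>_def image_iff by (subst up_to_scale_eq_iff) (auto simp: q_lattice_of_def)
  also have "\<dots> \<longleftrightarrow> (\<exists>w1 w2 u v. signed_area w1 w2 < 0 \<and> u \<in> Zhat \<and> v \<in> Zhat \<and>
      ?K = parabolic_shape w1 w2 u v)"
    by (rule scaled_parabolic_iff)
  also have "\<dots> \<longleftrightarrow> ?one"
  proof
    assume "\<exists>w1 w2 u v. signed_area w1 w2 < 0 \<and> u \<in> Zhat \<and> v \<in> Zhat \<and>
      ?K = parabolic_shape w1 w2 u v"
    then obtain w1 w2 u v where w: "signed_area w1 w2 < 0" and u: "u \<in> Zhat" and v: "v \<in> Zhat"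
      and K: "?K = parabolic_shape w1 w2 u v" by blast
    have area: "signed_area w1 w2 \<noteq> 0" using w by simp
    have span: "\<Lambda> = lattice_span w1 w2"
      using K by (simp add: q_lattice_of_def parabolic_shape_def)
    \<comment> \<open>The value of the morphism at \<open>(q, r)\<close>; putting \<open>r = 0\<close> or \<open>q = 0\<close> below isolates \<open>\<xi>\<close> or \<open>\<eta>\<close>.\<close>
    have K_val: "\<exists>t. \<xi> (coset_of \<int> q) \<otimes>\<^bsub>E_tor \<Lambda>\<^esub> \<eta> (coset_of \<int> r) = coset_of \<Lambda> (of_real t * w1 + of_real r * w2)"
      if qr: "q \<in> \<rat>" "r \<in> \<rat>" for q r
    proof -
      have p: "(coset_of \<int> q, coset_of \<int> r) \<in> carrier QZ2" using qr by (simp add: carrier_QZ)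
      obtain s t where st: "u (coset_of \<int> q) = coset_of \<int> s" "v (coset_of \<int> r) = coset_of \<int> t"
        using Tate_coset[OF u qr(1)] Tate_coset[OF v qr(2)] by metis
      have "snd ?K (coset_of \<int> q, coset_of \<int> r) = snd (parabolic_shape w1 w2 u v) (coset_of \<int> q, coset_of \<int> r)"
        by (simp only: K)
      then have "\<xi> (coset_of \<int> q) \<otimes>\<^bsub>E_tor \<Lambda>\<^esub> \<eta> (coset_of \<int> r)
          = combination_coset w1 w2 (coset_of \<int> (s + t)) (coset_of \<int> r)"
        using p by (simp add: q_lattice_of_def parabolic_shape_def st coset_of_mult add_subgroup_Ints
            del: mult_FactGroup carrier_DirProd)
      also have "\<dots> = coset_of \<Lambda> (of_real (s + t) * w1 + of_real r * w2)"
        unfolding combination_coset_eq span ..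
      finally show ?thesis by (rule exI)
    qed
    have zero: "\<xi> (coset_of \<int> 0) = coset_of \<Lambda> 0" "\<eta> (coset_of \<int> 0) = coset_of \<Lambda> 0"
      using Tate_0[OF N] \<xi>' \<eta>' by blast+
    obtain \<psi> where \<psi>: "\<psi> \<in> characters \<Lambda>" "\<And>z. \<psi> (coset_of \<Lambda> z) = coset_of \<int> (coord w1 w2 z)"
      using character_of_linear[OF \<Lambda> linear_coord[of w1 w2]] coord_lattice_span(1)[OF area] span by metis
    have "\<psi> (\<xi> (coset_of \<int> q)) = coset_of \<int> 0" if q: "q \<in> \<rat>" for q
    proof -
      obtain s where s: "\<xi> (coset_of \<int> q) = coset_of \<Lambda> s" using Tate_coset[OF \<xi>' q] by blast
      obtain t where "coset_of \<Lambda> s = coset_of \<Lambda> (of_real t * w1 + of_real 0 * w2)"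
        using K_val[OF q Rats_0] by (auto simp: s zero E_tor_def coset_of_mult[OF N] simp del: mult_FactGroup)
      then show ?thesis unfolding s using \<psi>(2) coord_combination[OF area] by metis
    qed
    moreover have "\<psi> (\<eta> (coset_of \<int> r)) = coset_of \<int> r" if r: "r \<in> \<rat>" for r
    proof -
      obtain s where s: "\<eta> (coset_of \<int> r) = coset_of \<Lambda> s" using Tate_coset[OF \<eta>' r] by blast
      obtain t where "coset_of \<Lambda> s = coset_of \<Lambda> (of_real t * w1 + of_real r * w2)"
        using K_val[OF Rats_0 r] by (auto simp: s zero E_tor_def coset_of_mult[OF N] simp del: mult_FactGroup)
      then show ?thesis unfolding s using \<psi>(2) coord_combination[OF area] by metis
    qed
    ultimately show ?one
      using \<psi>(1) unfolding perp_def Tate_map_eq_Zhat_zero_iff Tate_map_eq_Zhat_one_iff by blast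
  next
    assume ?one
    then obtain \<psi> where \<psi>: "\<psi> \<in> characters \<Lambda>" "Tate_map \<psi> \<xi> = Zhat_zero" "Tate_map \<psi> \<eta> = Zhat_one"
      unfolding perp_def by blast
    obtain w1 w2 where w: "signed_area w1 w2 < 0" and span: "\<Lambda> = lattice_span w1 w2"
      and \<psi>_coord: "\<And>z. \<psi> (coset_of \<Lambda> z) = coset_of \<int> (coord w1 w2 z)"
      using adapted_basis[OF \<Lambda> \<eta> \<psi>(1,3)] by blast
    have area: "signed_area w1 w2 \<noteq> 0" "signed_area w2 w1 \<noteq> 0"
      using w by (simp_all add: signed_area_swap[of w2 w1])
    let ?x = "coord w2 w1" and ?y = "coord w1 w2"
    define u where "u = (\<lambda>p\<in>carrier QZ. induced_map \<int> ?x (\<xi> p))"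
    define v where "v = (\<lambda>p\<in>carrier QZ. induced_map \<int> ?x (\<eta> p))"
    have x: "?x (y + z) = ?x y + ?x z" "?x ` \<Lambda> \<subseteq> \<int>" "?x ` rational_span \<Lambda> \<subseteq> \<rat>" for y z
      using linear_add[OF linear_coord] coord_lattice_span(2)[OF area(1)]
        lattice_span_rational_coord[OF area(1)] span by auto
    have u: "u \<in> Zhat" "v \<in> Zhat"
      unfolding u_def v_def
      by (rule Tate_induced_map[OF \<xi>' N add_subgroup_Ints x])
        (rule Tate_induced_map[OF \<eta>' N add_subgroup_Ints x])
    have "snd ?K = snd (parabolic_shape w1 w2 u v)"
    proof (rule extensionalityI[of _ "carrier QZ2"])
      fix p assume p: "p \<in> carrier QZ2"
      then obtain q r where qr: "q \<in> \<rat>" "r \<in> \<rat>" "p = (coset_of \<int> q, coset_of \<int> r)"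
        by (auto simp: carrier_QZ)
      have car: "coset_of \<int> q \<in> carrier QZ" "coset_of \<int> r \<in> carrier QZ"
        using qr by (auto simp: carrier_QZ)
      obtain s t where st: "\<xi> (coset_of \<int> q) = coset_of \<Lambda> s" "\<eta> (coset_of \<int> r) = coset_of \<Lambda> t"
        using Tate_coset[OF \<xi>' qr(1)] Tate_coset[OF \<eta>' qr(2)] by metis
      have "coset_of \<int> (?y s) = coset_of \<int> 0" "coset_of \<int> (?y t) = coset_of \<int> r"
        using \<psi>(2,3) qr st \<psi>_coord unfolding Tate_map_eq_Zhat_zero_iff Tate_map_eq_Zhat_one_iff
        by metis+
      then have y: "?y s \<in> \<int>" "?y t - r \<in> \<int>" by (simp_all add: Z)
      have uv: "u (coset_of \<int> q) = coset_of \<int> (?x s)" "v (coset_of \<int> r) = coset_of \<int> (?x t)"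
        using car N induced_map_coset[of \<int> \<Lambda> ?x, OF add_subgroup_Ints _ x(2,1)]
        by (auto simp: u_def v_def st add_subgroup_def)
      let ?z = "of_real (?x s + ?x t) * w1 + of_real r * w2"
      have split: "coord a b (s + t - ?z) = coord a b s + coord a b t - coord a b ?z" for a b
        by (simp only: linear_diff[OF linear_coord] linear_add[OF linear_coord])
      have "?x (s + t - ?z) = 0"
        unfolding split coord_combination_swap[OF area(1)] by simp
      moreover have "?y (s + t - ?z) = ?y s + (?y t - r)"
        unfolding split coord_combination[OF area(1)] by simp
      ultimately have "s + t - ?z \<in> \<Lambda>"
        using y unfolding span coord_lattice_span(2)[OF area(1)] by simp
      then have "coset_of \<Lambda> (s + t) = coset_of \<Lambda> ?z" by (simp only: coset_of_eq_iff[OF N])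
      moreover have "snd ?K p = coset_of \<Lambda> (s + t)"
        using p unfolding q_lattice_of_def
        by (simp add: qr(3) st E_tor_def coset_of_mult[OF N] del: mult_FactGroup carrier_DirProd)
      moreover have "snd (parabolic_shape w1 w2 u v) p = coset_of \<Lambda> ?z"
        using p unfolding parabolic_shape_def
        by (simp add: qr(3) uv coset_of_mult[OF add_subgroup_Ints] combination_coset_eq span
            del: mult_FactGroup carrier_DirProd)
      ultimately show "snd ?K p = snd (parabolic_shape w1 w2 u v) p" by simp
    qed (auto simp: q_lattice_of_def parabolic_shape_def)
    moreover have "fst ?K = fst (parabolic_shape w1 w2 u v)"
      by (simp add: q_lattice_of_def parabolic_shape_def span)
    ultimately have "?K = parabolic_shape w1 w2 u v" by (rule prod_eqI[rotated])
    then show "\<exists>w1 w2 u v. signed_area w1 w2 < 0 \<and> u \<in> Zhat \<and> v \<in> Zhat \<and>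
      ?K = parabolic_shape w1 w2 u v"
      using w u by blast
  qed
  finally show ?thesis .
qed

theorem theorem6p2:
  fixes \<Lambda> :: "complex set"
    and \<xi> \<eta> :: "real set \<Rightarrow> complex set"
  assumes "complex_lattice \<Lambda>"
    and "\<xi> \<in> Tate (E_tor \<Lambda>)" and "\<eta> \<in> Tate (E_tor \<Lambda>)"
    and "\<xi> \<noteq> zero_hom QZ (E_tor \<Lambda>)"
  shows "up_to_scale (q_lattice_of \<Lambda> \<xi> \<eta>) \<in> \<theta> ` parabolic_q_lattices \<longleftrightarrow>
         perp_pairing \<Lambda> \<xi> \<eta> = range Zhat_of_int"
  using parabolic_up_to_scale_iff_pairing_one[OF assms(1-3)]
    perp_pairing_eq_Ints_iff[OF assms(1,2,4,3)] by simp

end
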